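(* Let $A$ be an $m\times n$ matrix with integer entries, $n>m$, ${\rm rank}(A)=m$, columns ${\bf a}_1,\ldots,{\bf a}_n$, let ${\bf b}\in\mathbb{R}^m$, $P=\{{\bf x}\in\mathbb{R}^n:{\bf x}\geq0,\ A{\bf x}={\bf b}\}$, and let $X$ be the maximum-entropy random vector described in the context, with parameters $q_j$. Suppose $n=pm$ for an integer $p$, that ${\bf a}_{(k-1)m+1},\ldots,{\bf a}_{km}$ are linearly independent for $1\leq k\leq p$, and that $\langle{\bf a}_j,{\bf b}\rangle>0$ for $1\leq j\leq n$. Let $\gamma>0$ and define $\alpha_j:=\frac{2q_j}{(1-q_j)^2}$ $(1\leq j\leq n)$, $\alpha^\vee_i:=\min\{\alpha_{(k-1)m+i}:1\leq k\leq p\}$ and $q^\vee_i:=\min\{q_{(k-1)m+i}:1\leq k\leq p\}$ $(1\leq i\leq m)$, $$c_i:=\max\Big\{\frac{1}{\gamma^2}\ln\Big[1+\alpha^\vee_i\big(1-\cos\tfrac{\gamma}{\sqrt{\alpha^\vee_i}}\big)\Big],\ \frac{1}{\alpha^\vee_i\pi^2}\ln\big[1+2\alpha^\vee_i\big]\Big\}\quad(1\leq i\leq m),$$ $C:=\prod_{i=1}^m(2\pi c_i\alpha^\vee_i)^{-1/2}$ and $C':=\max_{1\leq i\leq m}e^{-\gamma^2c_i/2}$. Then $$|P\cap\mathbb{Z}^n|\ \leq\ e^{H(X)}\big(Cp^{-m/2}+(C')^p\big).$$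
   Context: $X=(X_1,\ldots,X_n)$ is the random vector with values in $\mathbb{Z}_{\geq 0}^n$ of maximum entropy subject to ${\bf E}[AX]={\bf b}$ (assumed to exist), with entropy $H(X)=-\sum_{{\bf k}}{\bf Pr}[X={\bf k}]\ln{\bf Pr}[X={\bf k}]$. Its coordinates are independent and geometrically distributed: ${\bf Pr}[X_j=k]=(1-q_j)q_j^k$, $q_j\in[0,1)$. *)

theory Defs
  imports "HOL-Probability.Probability"
begin

definition polyhedron_P :: "real^'n^'m \<Rightarrow> real^'m \<Rightarrow> (real^'n) set" where
  "polyhedron_P A b = {x. (\<forall>j. 0 \<le> x $ j) \<and> A *v x = b}"

definition integer_points :: "(real^'n) set" where
  "integer_points = {x. \<forall>j. x $ j \<in> \<int>}"

definition real_vec :: "nat^'n \<Rightarrow> real^'n" where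
  "real_vec k = (\<chi> j. real (k $ j))"

text \<open>
  A random vector with values in the nonnegative integer vectors is represented by its
  distribution. The entropy is the sum of the nonnegative terms
  \<open>- Pr[X = k] ln Pr[X = k]\<close>, with \<open>0 ln 0 = 0\<close>. It is taken in the extended
  nonnegative reals so that a divergent sum counts as \<open>\<infinity>\<close> and not as \<open>0\<close>.
\<close>

definition entropy_pmf :: "'a pmf \<Rightarrow> ennreal" where
  "entropy_pmf X = (\<integral>\<^sup>+ k. ennreal (- (pmf X k * ln (pmf X k))) \<partial>count_space UNIV)"

text \<open>\<open>E[AX] = b\<close>, including the existence of the expectation.\<close>

definition has_mean_image :: "real^'n^'m \<Rightarrow> real^'m \<Rightarrow> (nat^'n) pmf \<Rightarrow> bool" where
  "has_mean_image A b X \<longleftrightarrow>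
     has_bochner_integral (measure_pmf X) (\<lambda>k. A *v real_vec k) b"

definition max_entropy :: "real^'n^'m \<Rightarrow> real^'m \<Rightarrow> (nat^'n) pmf \<Rightarrow> bool" where
  "max_entropy A b X \<longleftrightarrow>
     has_mean_image A b X \<and> (\<forall>Y. has_mean_image A b Y \<longrightarrow> entropy_pmf Y \<le> entropy_pmf X)"

end

theory Submission
  imports Defs
begin

text \<open>
  Mixing \<open>X\<close> with a point mass at a lattice point \<open>x\<close> of \<open>P\<close> preserves the constraint, so the
  entropy cannot grow along this perturbation. Its derivative at \<open>0\<close> is \<open>- H(X) - ln Pr[X = x]\<close>;
  hence \<open>Pr[X = x] \<ge> exp (- H(X))\<close> and the number of lattice points is at most
  \<open>exp (H(X)) Pr[AX = b]\<close>.

  The probability is bounded by Fourier analysis on the finite group \<open>(\<int>/N)\<^sup>m\<close> instead of the torus.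
  The characteristic function of \<open>X\<^sub>j\<close> has modulus \<open>(1 + \<alpha>\<^sub>j (1 - cos \<theta>))\<^bsup>-1/2\<^esup>\<close>, and the inequality of
  arithmetic and geometric means separates the \<open>p\<close> blocks of columns. If \<open>N\<close> is coprime to the
  determinant of a block, the block permutes \<open>(\<int>/N)\<^sup>m\<close>, so the variables can be decoupled
  exactly. Since \<open>ln (1 + \<alpha> (1 - cos \<theta>)) / \<theta>\<^sup>2\<close> decreases on \<open>(0, \<pi>]\<close>, each factor is dominated by a
  Gaussian up to \<open>\<gamma> / sqrt \<alpha>\<close> and by a constant beyond. The Gaussian sums converge to Gaussian
  integrals as \<open>N\<close> tends to infinity along \<open>N \<equiv> 1\<close> modulo twice the product of the determinants.
\<close>

section \<open>The entropy of maximum-entropy distributions\<close>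

text \<open>With counting measure as common reference, an integral against a mixture becomes a
  linear combination of integrals against its components.\<close>

lemma has_bochner_integral_measure_pmf_iff:
  fixes f :: "'a \<Rightarrow> 'b::{banach, second_countable_topology}"
  shows "has_bochner_integral (measure_pmf X) f z \<longleftrightarrow>
    has_bochner_integral (count_space UNIV) (\<lambda>k. pmf X k *\<^sub>R f k) z"
  by (simp add: has_bochner_integral_iff measure_pmf_eq_density integrable_density integral_density)

lemma has_bochner_integral_count_space_single:
  fixes f :: "'a \<Rightarrow> 'b::{banach, second_countable_topology}"
  shows "has_bochner_integral (count_space UNIV) (\<lambda>k. indicator {x} k *\<^sub>R f k) (f x)"
proof -
  have "has_bochner_integral (count_space UNIV) (\<lambda>k. indicator {x} k *\<^sub>R f x) (f x)"
    using has_bochner_integral_indicator[of "{x}" "count_space UNIV" "f x"] by simp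
  also have "(\<lambda>k. indicator {x} k *\<^sub>R f x) = (\<lambda>k. indicator {x} k *\<^sub>R f k)"
    by (auto simp: fun_eq_iff indicator_def)
  finally show ?thesis .
qed

lemma has_bochner_integral_pmf: "has_bochner_integral (count_space UNIV) (pmf X) 1"
  using has_bochner_integral_measure_pmf_iff[of X "\<lambda>_. 1::real" 1]
  by (simp add: has_bochner_integral_iff measure_pmf.prob_space[simplified])

lemma neg_xlogx_nonneg: "0 \<le> - (x * ln x)" if "0 \<le> x" "x \<le> 1" for x :: real
  using that mult_nonneg_nonpos[of x "ln x"] by (cases "x = 0") (auto simp: ln_le_zero_iff)

text \<open>The perturbation of \<open>X\<close> towards the point mass at \<open>x\<close>.
  Choosing the component by a Bernoulli variable makes it a \<open>pmf\<close> by
  construction.\<close>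

definition mix_pmf :: "real \<Rightarrow> 'a \<Rightarrow> 'a pmf \<Rightarrow> 'a pmf" where
  "mix_pmf \<epsilon> x X = bind_pmf (bernoulli_pmf \<epsilon>) (\<lambda>B. if B then return_pmf x else X)"

lemma pmf_mix:
  assumes "0 \<le> \<epsilon>" "\<epsilon> \<le> 1"
  shows "pmf (mix_pmf \<epsilon> x X) k = \<epsilon> * indicator {x} k + (1 - \<epsilon>) * pmf X k"
  using assms by (simp add: mix_pmf_def pmf_bind indicator_def)

lemma has_mean_image_mix:
  assumes "0 \<le> \<epsilon>" "\<epsilon> \<le> 1" "has_mean_image A b X" "A *v real_vec x = b"
  shows "has_mean_image A b (mix_pmf \<epsilon> x X)"
proof -
  let ?f = "\<lambda>k. A *v real_vec k"
  have "has_bochner_integral (count_space UNIV)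
     (\<lambda>k. \<epsilon> *\<^sub>R (indicator {x} k *\<^sub>R ?f k) + (1 - \<epsilon>) *\<^sub>R (pmf X k *\<^sub>R ?f k)) (\<epsilon> *\<^sub>R ?f x + (1 - \<epsilon>) *\<^sub>R b)"
    using assms(3) unfolding has_mean_image_def has_bochner_integral_measure_pmf_iff
    by (intro has_bochner_integral_add has_bochner_integral_scaleR_right
          has_bochner_integral_count_space_single)
  moreover have "\<epsilon> *\<^sub>R ?f x + (1 - \<epsilon>) *\<^sub>R b = b"
    using assms(4) by (simp flip: scaleR_add_left)
  ultimately show ?thesis
    unfolding has_mean_image_def has_bochner_integral_measure_pmf_iff
    using assms(1,2) by (simp add: pmf_mix scaleR_add_left)
qed

lemma has_bochner_integral_entropy_pmf:
  assumes "entropy_pmf X \<noteq> \<infinity>"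
  shows "has_bochner_integral (count_space UNIV) (\<lambda>k. - (pmf X k * ln (pmf X k))) (enn2real (entropy_pmf X))"
proof (rule has_bochner_integral_nn_integral)
  show "(\<integral>\<^sup>+ k. ennreal (- (pmf X k * ln (pmf X k))) \<partial>count_space UNIV) = ennreal (enn2real (entropy_pmf X))"
    using assms by (simp add: entropy_pmf_def less_top)
qed (auto intro!: AE_I2 neg_xlogx_nonneg[OF _ pmf_le_1, simplified])

text \<open>Off \<open>x\<close> the weights of the mixture are
  \<open>(1 - \<epsilon>) * pmf X k\<close>, so the logarithm splits and the entropy becomes a
  multiple of \<open>H\<close> plus a multiple of the total mass. Only the term at \<open>x\<close>
  needs a correction.\<close>

lemma entropy_pmf_mix:
  fixes x :: 'a
  assumes eps: "0 \<le> \<epsilon>" "\<epsilon> < 1" and fin: "entropy_pmf X \<noteq> \<infinity>"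
  defines "p \<equiv> pmf X x" and "H \<equiv> enn2real (entropy_pmf X)"
  shows "entropy_pmf (mix_pmf \<epsilon> x X) = ennreal ((1 - \<epsilon>) * (H + p * ln p)
           - (1 - \<epsilon>) * ln (1 - \<epsilon>) * (1 - p) - (\<epsilon> + (1 - \<epsilon>) * p) * ln (\<epsilon> + (1 - \<epsilon>) * p))"
proof -
  \<comment> \<open>\<open>D\<close> is the true term at \<open>x\<close> minus what the formula
    valid elsewhere would give there.\<close>
  define D where "D = - ((\<epsilon> + (1 - \<epsilon>) * p) * ln (\<epsilon> + (1 - \<epsilon>) * p)) + (1 - \<epsilon>) * (p * ln p)
     + (1 - \<epsilon>) * ln (1 - \<epsilon>) * p"
  let ?Y = "mix_pmf \<epsilon> x X"
  have "has_bochner_integral (count_space UNIV)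
     (\<lambda>k. (1 - \<epsilon>) *\<^sub>R (- (pmf X k * ln (pmf X k))) + (- ((1 - \<epsilon>) * ln (1 - \<epsilon>))) *\<^sub>R pmf X k
         + indicator {x} k *\<^sub>R D)
     ((1 - \<epsilon>) *\<^sub>R H + (- ((1 - \<epsilon>) * ln (1 - \<epsilon>))) *\<^sub>R 1 + D)"
    unfolding H_def
    by (intro has_bochner_integral_add has_bochner_integral_scaleR_right has_bochner_integral_pmf
        has_bochner_integral_entropy_pmf[OF fin] has_bochner_integral_count_space_single)
  also have "(\<lambda>k. (1 - \<epsilon>) *\<^sub>R (- (pmf X k * ln (pmf X k))) + (- ((1 - \<epsilon>) * ln (1 - \<epsilon>))) *\<^sub>R pmf X k
         + indicator {x} k *\<^sub>R D) = (\<lambda>k. - (pmf ?Y k * ln (pmf ?Y k)))" (is "?l = ?r")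
  proof
    fix k show "?l k = ?r k"
    proof (cases "k = x")
      case True
      then show ?thesis using eps by (simp add: pmf_mix D_def p_def algebra_simps)
    next
      case False
      show ?thesis
      proof (cases "pmf X k = 0")
        case True
        with False show ?thesis using eps by (simp add: pmf_mix)
      next
        case nz: False
        then have "pmf X k > 0" by (simp add: pmf_pos)
        then have "ln ((1 - \<epsilon>) * pmf X k) = ln (1 - \<epsilon>) + ln (pmf X k)"
          using eps by (simp add: ln_mult)
        moreover have "pmf ?Y k = (1 - \<epsilon>) * pmf X k" using False eps by (simp add: pmf_mix)
        ultimately have "pmf ?Y k * ln (pmf ?Y k) = (1 - \<epsilon>) * pmf X k * (ln (1 - \<epsilon>) + ln (pmf X k))"
          by simp
        then show ?thesis using False by (simp add: algebra_simps)
      qed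
    qed
  qed
  finally have hb: "has_bochner_integral (count_space UNIV) ?r ((1 - \<epsilon>) *\<^sub>R H + (- ((1 - \<epsilon>) * ln (1 - \<epsilon>))) *\<^sub>R 1 + D)" .
  have "entropy_pmf ?Y = ennreal (integral\<^sup>L (count_space UNIV) ?r)"
    unfolding entropy_pmf_def
    by (rule nn_integral_eq_integral)
       (use hb in \<open>auto simp: has_bochner_integral_iff intro!: AE_I2 neg_xlogx_nonneg[OF _ pmf_le_1, simplified]\<close>)
  also have "integral\<^sup>L (count_space UNIV) ?r = (1 - \<epsilon>) *\<^sub>R H + (- ((1 - \<epsilon>) * ln (1 - \<epsilon>))) *\<^sub>R 1 + D"
    using hb by (simp add: has_bochner_integral_iff)
  finally show ?thesis by (simp add: D_def algebra_simps)
qed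

lemma max_entropy_pmf_ge:
  assumes X: "max_entropy A b X" and fin: "entropy_pmf X \<noteq> \<infinity>" and x: "A *v real_vec x = b"
  shows "exp (- enn2real (entropy_pmf X)) \<le> pmf X x"
proof -
  define p where "p = pmf X x"
  define H where "H = enn2real (entropy_pmf X)"
  define f where "f = (\<lambda>\<epsilon>. (1 - \<epsilon>) * (H + p * ln p)
           - (1 - \<epsilon>) * ln (1 - \<epsilon>) * (1 - p) - (\<epsilon> + (1 - \<epsilon>) * p) * ln (\<epsilon> + (1 - \<epsilon>) * p))"
  have p01: "0 \<le> p" "p \<le> 1" by (auto simp: p_def pmf_le_1)
  have le: "f \<epsilon> \<le> H" if "0 \<le> \<epsilon>" "\<epsilon> < 1" for \<epsilon>
  proof -
    have "has_mean_image A b (mix_pmf \<epsilon> x X)"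
      using that X x by (intro has_mean_image_mix) (auto simp: max_entropy_def)
    then have "entropy_pmf (mix_pmf \<epsilon> x X) \<le> entropy_pmf X"
      using X by (auto simp: max_entropy_def)
    also have "entropy_pmf (mix_pmf \<epsilon> x X) = ennreal (f \<epsilon>)"
      using entropy_pmf_mix[OF that fin] by (simp add: f_def p_def H_def)
    also have "entropy_pmf X = ennreal H"
      using fin by (simp add: H_def less_top)
    finally show ?thesis by (simp add: H_def ennreal_le_iff)
  qed
  show ?thesis
  proof (cases "p = 0")
    case True
    \<comment> \<open>Here \<open>- \<epsilon> * ln \<epsilon>\<close> has infinite slope at 0, so
      no derivative is available. With this \<open>\<epsilon>\<close> the point mass contributes
      \<open>\<epsilon> * (H + 1)\<close>, which exceeds the loss \<open>\<epsilon> * H\<close> and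
      contradicts maximality.\<close>
    define \<epsilon> where "\<epsilon> = exp (- H - 1)"
    have H0: "H \<ge> 0" by (simp add: H_def)
    then have e: "0 < \<epsilon>" "\<epsilon> < 1" by (auto simp: \<epsilon>_def)
    have "f \<epsilon> = (1 - \<epsilon>) * H - (1 - \<epsilon>) * ln (1 - \<epsilon>) - \<epsilon> * ln \<epsilon>"
      using True by (simp add: f_def)
    moreover have "0 \<le> - ((1 - \<epsilon>) * ln (1 - \<epsilon>))" using e by (intro neg_xlogx_nonneg) auto
    moreover have "\<epsilon> * ln \<epsilon> = - \<epsilon> * H - \<epsilon>" by (simp add: \<epsilon>_def algebra_simps)
    ultimately have "f \<epsilon> \<ge> H + \<epsilon>" by (simp add: algebra_simps)
    with le[of \<epsilon>] e show ?thesis by simp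
  next
    case False
    with p01 have p: "p > 0" by simp
    have "(f has_real_derivative (- H - ln p)) (at 0)"
      unfolding f_def using p
      by (auto intro!: derivative_eq_intros simp: field_simps)
    moreover have "f 0 = H" by (simp add: f_def)
    ultimately have "- H - ln p \<le> 0"
    proof (rule_tac ccontr)
      assume d: "(f has_real_derivative (- H - ln p)) (at 0)" "f 0 = H" "\<not> - H - ln p \<le> 0"
      from DERIV_pos_inc_right[OF d(1)] d(3)
      obtain \<delta> where \<delta>: "\<delta> > 0" "\<And>h. 0 < h \<Longrightarrow> h < \<delta> \<Longrightarrow> f 0 < f (0 + h)" by auto
      \<comment> \<open>The cap 1/2 keeps the parameter below 1, as \<open>le\<close>
        demands.\<close>
      have "f 0 < f (min (\<delta>/2) (1/2))" using \<delta>(2)[of "min (\<delta>/2) (1/2)"] \<delta>(1) by auto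
      with le[of "min (\<delta>/2) (1/2)"] \<delta>(1) d(2) show False by (simp add: min_less_iff_disj)
    qed
    then have "exp (- H) \<le> exp (ln p)" by simp
    with p show ?thesis by (simp add: p_def H_def)
  qed
qed

section \<open>Estimates for a single variable\<close>

text \<open>\<open>x\<close> is a convex combination of 0 and \<open>y\<close>, and sine is concave
  on the interval from 0 to pi with value 0 at 0.\<close>

lemma sin_ratio_antimono:
  fixes x y :: real
  assumes "0 < x" "x \<le> y" "y \<le> pi"
  shows "x * sin y \<le> y * sin x"
proof -
  have "concave_on {0..pi} sin"
    by (rule f''_le0_imp_concave[where f' = cos and f'' = "\<lambda>x. - sin x"])
       (auto intro!: derivative_eq_intros sin_ge_zero)
  from concave_onD[OF this, of "x / y" 0 y] assms
  have "x / y * sin y \<le> sin x" by (auto simp: divide_simps)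
  with assms show ?thesis by (simp add: field_simps)
qed

text \<open>The half-angle formula turns \<open>1 - cos z\<close> into
  \<open>2 * (sin (z / 2))\<^sup>2\<close>, so this is the square of the monotonicity of
  \<open>sin z / z\<close> at half the angles.\<close>

lemma one_minus_cos_ratio_antimono:
  fixes x y :: real
  assumes "0 < x" "x \<le> y" "y \<le> pi"
  shows "x\<^sup>2 * (1 - cos y) \<le> y\<^sup>2 * (1 - cos x)"
proof -
  have half: "1 - cos z = 2 * (sin (z / 2))\<^sup>2" for z :: real
    using cos_double_sin[of "z / 2"] by simp
  have "x / 2 * sin (y / 2) \<le> y / 2 * sin (x / 2)"
    using assms by (intro sin_ratio_antimono) auto
  then have "x * sin (y / 2) \<le> y * sin (x / 2)" by simp
  moreover have "0 \<le> x * sin (y / 2)"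
    using assms by (intro mult_nonneg_nonneg sin_ge_zero) auto
  ultimately have "(x * sin (y / 2))\<^sup>2 \<le> (y * sin (x / 2))\<^sup>2" by (rule power_mono)
  then show ?thesis by (simp add: half power_mult_distrib)
qed

text \<open>The chords of the concave logarithm that start at 1 have decreasing slopes.\<close>

lemma ln_one_plus_ratio_antimono:
  fixes v w :: real
  assumes "0 < v" "v \<le> w"
  shows "v * ln (1 + w) \<le> w * ln (1 + v)"
proof -
  have eq: "(1 - v / w) *\<^sub>R 1 + (v / w) *\<^sub>R (1 + w) = 1 + v"
    using assms by (simp add: field_simps)
  from concave_onD[OF ln_concave, of "v / w" 1 "1 + w"] assms
  have "v / w * ln (1 + w) \<le> ln ((1 - v / w) *\<^sub>R 1 + (v / w) *\<^sub>R (1 + w))" by simp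
  then have "v / w * ln (1 + w) \<le> ln (1 + v)" unfolding eq .
  with assms show ?thesis by (simp add: field_simps)
qed

text \<open>With \<open>v = a * (1 - cos x)\<close>, the ratio \<open>ln (1 + v) / x\<^sup>2\<close>
  is the product of \<open>ln (1 + v) / v\<close> and \<open>v / x\<^sup>2\<close>. Both are
  nonincreasing in \<open>x\<close>, the first since \<open>v\<close> grows with \<open>x\<close> up
  to pi.\<close>

lemma ln_cos_ratio_antimono:
  fixes a x y :: real
  assumes a: "0 < a" and xy: "0 < x" "x \<le> y" "y \<le> pi"
  shows "x\<^sup>2 * ln (1 + a * (1 - cos y)) \<le> y\<^sup>2 * ln (1 + a * (1 - cos x))"
proof -
  define v where "v = a * (1 - cos x)"
  define w where "w = a * (1 - cos y)"
  have "cos x < cos 0" using xy by (intro cos_monotone_0_pi) auto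
  then have v: "v > 0" using a by (simp add: v_def)
  have "cos y \<le> cos x" using xy by (intro cos_monotone_0_pi_le) auto
  then have vw: "v \<le> w" using a by (simp add: v_def w_def)
  have 1: "x\<^sup>2 * w \<le> y\<^sup>2 * v"
    using mult_left_mono[OF one_minus_cos_ratio_antimono[OF xy], of a] a
    by (simp add: v_def w_def algebra_simps)
  have 2: "v * ln (1 + w) \<le> w * ln (1 + v)"
    using v vw by (rule ln_one_plus_ratio_antimono)
  have "v * (x\<^sup>2 * ln (1 + w)) \<le> x\<^sup>2 * w * ln (1 + v)"
    using mult_left_mono[OF 2, of "x\<^sup>2"] by (simp add: algebra_simps)
  also have "\<dots> \<le> y\<^sup>2 * v * ln (1 + v)"
    using 1 v by (intro mult_right_mono) auto
  also have "\<dots> = v * (y\<^sup>2 * ln (1 + v))" by simp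
  finally have "x\<^sup>2 * ln (1 + w) \<le> y\<^sup>2 * ln (1 + v)"
    using v by (rule mult_left_le_imp_le)
  then show ?thesis by (simp add: v_def w_def)
qed

text \<open>The maximum is attained by the first term if \<open>\<gamma> / sqrt a \<le> pi\<close> and by the second one otherwise.\<close>

lemma ln_cos_lower_bound:
  fixes a \<gamma> c \<theta> :: real
  assumes a: "0 < a" and \<gamma>: "0 < \<gamma>"
    and c: "c = max (1 / \<gamma>\<^sup>2 * ln (1 + a * (1 - cos (\<gamma> / sqrt a)))) (1 / (a * pi\<^sup>2) * ln (1 + 2 * a))"
    and \<theta>: "\<bar>\<theta>\<bar> \<le> pi"
  shows "min (c * a * \<theta>\<^sup>2) (\<gamma>\<^sup>2 * c) \<le> ln (1 + a * (1 - cos \<theta>))"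
proof -
  define F where "F = (\<lambda>t. ln (1 + a * (1 - cos t)))"
  define \<tau> where "\<tau> = \<gamma> / sqrt a"
  have \<tau>: "\<tau> > 0" "\<gamma>\<^sup>2 = a * \<tau>\<^sup>2"
    using a \<gamma> by (auto simp: \<tau>_def power_divide)
  have c': "c = max (F \<tau> / (a * \<tau>\<^sup>2)) (F pi / (a * pi\<^sup>2))"
    by (simp add: c \<tau>(2) F_def \<tau>_def mult.commute)
  have mono: "x\<^sup>2 * F y \<le> y\<^sup>2 * F x" if "0 < x" "x \<le> y" "y \<le> pi" for x y
    using ln_cos_ratio_antimono[OF a that] by (simp add: F_def)
  have F0: "F t \<ge> 0" for t using a by (auto simp: F_def intro!: ln_ge_zero mult_nonneg_nonneg)
  have Fpi: "F t \<le> F pi" for t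
    using a cos_ge_minus_one[of t] cos_le_one[of t] by (auto simp: F_def intro!: ln_mono add_pos_nonneg)
  \<comment> \<open>The constant \<open>c\<close> makes the parabola
    \<open>c * a * \<theta>\<^sup>2\<close> meet \<open>F\<close> at \<open>\<mu>\<close>, so the
    parabola lies below \<open>F\<close> up to there. The cut at pi reflects the range of
    \<open>mono\<close>.\<close>
  define \<mu> where "\<mu> = min \<tau> pi"
  have \<mu>: "0 < \<mu>" "\<mu> \<le> pi" "\<mu> \<le> \<tau>" using \<tau> by (auto simp: \<mu>_def)
  have c\<mu>: "c = F \<mu> / (a * \<mu>\<^sup>2)"
  proof (cases "\<tau> \<le> pi")
    case True
    then have "F pi / (a * pi\<^sup>2) \<le> F \<tau> / (a * \<tau>\<^sup>2)"
      using mono[of \<tau> pi] \<tau>(1) a by (simp add: field_simps)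
    with True show ?thesis by (simp add: c' \<mu>_def)
  next
    case False
    \<comment> \<open>Beyond pi the estimate \<open>mono\<close> does not apply, but pi maximizes
      \<open>F\<close> and has the smaller denominator.\<close>
    then have "F \<tau> / (a * \<tau>\<^sup>2) \<le> F pi / (a * pi\<^sup>2)"
      using Fpi[of \<tau>] F0[of pi] a by (intro frac_le mult_left_mono power_mono) auto
    with False show ?thesis by (simp add: c' \<mu>_def)
  qed
  have Fabs: "F \<theta> = F \<bar>\<theta>\<bar>" by (simp add: F_def)
  have "min (c * a * \<theta>\<^sup>2) (\<gamma>\<^sup>2 * c) \<le> F \<theta>"
  proof (cases "\<bar>\<theta>\<bar> \<le> \<mu>")
    case True
    have "c * a * \<theta>\<^sup>2 \<le> F \<theta>"
    proof (cases "\<theta> = 0")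
      case False
      then show ?thesis using mono[of "\<bar>\<theta>\<bar>" \<mu>] True \<mu> a
        by (simp add: c\<mu> Fabs[symmetric] field_simps)
    qed (simp add: F_def)
    then show ?thesis by simp
  next
    case False
    \<comment> \<open>Since \<open>\<bar>\<theta>\<bar>\<close> is at most pi, exceeding
      \<open>\<mu>\<close> excludes \<open>\<mu> = pi\<close>.\<close>
    then have "\<mu> = \<tau>" using \<theta> by (auto simp: \<mu>_def min_def split: if_splits)
    then have "\<gamma>\<^sup>2 * c = F \<tau>" using \<tau> a by (simp add: c\<mu>)
    also have "F \<tau> \<le> F \<bar>\<theta>\<bar>"
    proof -
      have "cos \<bar>\<theta>\<bar> \<le> cos \<tau>" using False \<open>\<mu> = \<tau>\<close> \<theta> \<tau> by (intro cos_monotone_0_pi_le) auto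
      then show ?thesis using a cos_le_one[of \<tau>]
        by (auto simp: F_def intro!: ln_mono add_pos_nonneg mult_nonneg_nonneg)
    qed
    finally show ?thesis by (simp add: Fabs)
  qed
  then show ?thesis by (simp add: F_def)
qed

text \<open>The form is a disjunction because in a product over coordinates one factor of the second
  kind suffices, while otherwise all factors are Gaussian.\<close>

lemma cos_factor_power_le:
  fixes a \<gamma> c \<theta> :: real and p :: nat
  assumes a: "0 < a" and \<gamma>: "0 < \<gamma>"
    and c: "c = max (1 / \<gamma>\<^sup>2 * ln (1 + a * (1 - cos (\<gamma> / sqrt a)))) (1 / (a * pi\<^sup>2) * ln (1 + 2 * a))"
    and \<theta>: "\<bar>\<theta>\<bar> \<le> pi"
  shows "(1 + a * (1 - cos \<theta>)) powr (- real p / 2) \<le> exp (- (real p * c * a / 2 * \<theta>\<^sup>2)) \<or>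
         (1 + a * (1 - cos \<theta>)) powr (- real p / 2) \<le> exp (- (\<gamma>\<^sup>2 * c / 2)) ^ p"
proof -
  let ?l = "ln (1 + a * (1 - cos \<theta>))"
  have pos: "1 + a * (1 - cos \<theta>) > 0" using a by (auto intro!: add_pos_nonneg mult_nonneg_nonneg)
  have eq: "(1 + a * (1 - cos \<theta>)) powr (- real p / 2) = exp (- (real p / 2 * ?l))"
    using pos by (simp add: powr_def)
  from ln_cos_lower_bound[OF assms] consider "c * a * \<theta>\<^sup>2 \<le> ?l" | "\<gamma>\<^sup>2 * c \<le> ?l"
    by (auto simp: min_le_iff_disj)
  then show ?thesis
  proof cases
    case 1
    from mult_left_mono[OF this, of "real p / 2"] show ?thesis
      unfolding eq by (intro disjI1) (simp add: mult.assoc mult.left_commute)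
  next
    case 2
    from mult_left_mono[OF this, of "real p / 2"] show ?thesis
      unfolding eq by (intro disjI2) (simp flip: exp_of_nat_mult)
  qed
qed

section \<open>Gaussian sums and integrals\<close>

text \<open>The integrand decreases on the nonnegative half-line, so its value at the right end of a
  unit interval is at most its integral over that interval.\<close>

lemma sum_le_half_gaussian_integral:
  fixes l :: real
  assumes l: "0 < l"
  shows "(\<Sum>s=1..M. exp (- (l * (real s)\<^sup>2))) \<le> sqrt (pi / l) / 2"
proof -
  let ?f = "\<lambda>x. exp (- (l * x\<^sup>2))"
  have "has_bochner_integral lborel (\<lambda>x. indicator {0..} (0 + sqrt l * x) *\<^sub>R exp (- (0 + sqrt l * x)\<^sup>2))
      ((sqrt pi / 2) /\<^sub>R \<bar>sqrt l\<bar>)"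
    using gaussian_moment_0 lborel_has_bochner_integral_real_affine_iff[of "sqrt l" "\<lambda>x. indicator {0..} x *\<^sub>R exp (- x\<^sup>2)" "sqrt pi / 2" 0] l
    by simp
  also have "(\<lambda>x. indicator {0..} (0 + sqrt l * x) *\<^sub>R exp (- (0 + sqrt l * x)\<^sup>2)) = (\<lambda>x. indicator {0..} x *\<^sub>R ?f x)"
    using l by (auto simp: fun_eq_iff indicator_def power_mult_distrib zero_le_mult_iff)
  also have "(sqrt pi / 2) /\<^sub>R \<bar>sqrt l\<bar> = sqrt (pi / l) / 2"
    using l by (simp add: real_sqrt_divide field_simps)
  finally have G: "has_bochner_integral lborel (\<lambda>x. indicator {0..} x *\<^sub>R ?f x) (sqrt (pi / l) / 2)" .
  \<comment> \<open>\<open>?g\<close> is the step function of right-endpoint values. Its intervals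
    are disjoint, so at most one summand is nonzero at each point.\<close>
  let ?g = "\<lambda>x. \<Sum>s=1..M. ?f (real s) * indicator {real s - 1<..real s} x"
  have g: "has_bochner_integral lborel ?g (\<Sum>s=1..M. ?f (real s) * 1)"
  proof (intro has_bochner_integral_sum has_bochner_integral_mult_right)
    fix s :: nat
    show "has_bochner_integral lborel (indicator {real s - 1<..real s}) (1::real)"
      using has_bochner_integral_real_indicator[of "{real s - 1<..real s}" lborel] by simp
  qed
  have "integral\<^sup>L lborel ?g \<le> integral\<^sup>L lborel (\<lambda>x. indicator {0..} x *\<^sub>R ?f x)"
  proof (rule integral_mono)
    fix x :: real
    show "?g x \<le> indicator {0..} x *\<^sub>R ?f x"
    proof (cases "\<exists>s\<in>{1..M}. x \<in> {real s - 1<..real s}")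
      case True
      then obtain s where s: "s \<in> {1..M}" "x \<in> {real s - 1<..real s}" by blast
      have "?g x = (\<Sum>r=1..M. if r = s then ?f (real s) else 0)"
      proof (rule sum.cong)
        fix r assume "r \<in> {1..M}"
        have "x \<in> {real r - 1<..real r} \<longleftrightarrow> r = s"
        proof
          assume "x \<in> {real r - 1<..real r}"
          with s have "real r < real s + 1" "real s < real r + 1" by auto
          then show "r = s" by linarith
        qed (use s in simp)
        then show "?f (real r) * indicator {real r - 1<..real r} x = (if r = s then ?f (real s) else 0)"
          by (auto simp: indicator_def)
      qed simp
      also have "\<dots> = ?f (real s)" using s by simp
      also have "\<dots> \<le> ?f x" using s l by (auto intro!: mult_left_mono power_mono)
      finally show ?thesis using s by (auto simp: indicator_def)
    next
      case False
      then have "?g x = 0" by (intro sum.neutral) (auto simp: indicator_def)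
      then show ?thesis by (simp add: indicator_def)
    qed
  qed (use g G in \<open>auto simp: has_bochner_integral_iff\<close>)
  then show ?thesis using g G by (simp add: has_bochner_integral_iff)
qed

text \<open>The two halves are mirror images. The 1 is the term at 0; it becomes negligible once the
  sum is divided by the growing grid size.\<close>

lemma symmetric_gaussian_sum_le:
  fixes l :: real
  assumes l: "0 < l"
  shows "(\<Sum>s\<in>{- int M..int M}. exp (- (l * (real_of_int s)\<^sup>2))) \<le> 1 + sqrt (pi / l)"
proof -
  let ?f = "\<lambda>s::int. exp (- (l * (real_of_int s)\<^sup>2))"
  have split: "{- int M..int M} = uminus ` int ` {1..M} \<union> ({0} \<union> int ` {1..M})"
  proof (intro equalityI subsetI)
    fix x assume x: "x \<in> {- int M..int M}"
    show "x \<in> uminus ` int ` {1..M} \<union> ({0} \<union> int ` {1..M})"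
    proof (cases "x < 0")
      case True
      then have "x = - int (nat (- x))" "nat (- x) \<in> {1..M}" using x by auto
      then show ?thesis by blast
    next
      case False
      then have "x = 0 \<or> x = int (nat x) \<and> nat x \<in> {1..M}" using x by auto
      then show ?thesis by blast
    qed
  qed auto
  have "sum ?f {- int M..int M} = sum ?f (uminus ` int ` {1..M}) + (1 + sum ?f (int ` {1..M}))"
    unfolding split by (subst sum.union_disjoint; (subst sum.union_disjoint)?) auto
  also have "sum ?f (uminus ` int ` {1..M}) = sum ?f (int ` {1..M})"
    by (subst sum.reindex) (auto simp: inj_on_def)
  also have "sum ?f (int ` {1..M}) = (\<Sum>s=1..M. exp (- (l * (real s)\<^sup>2)))"
    by (subst sum.reindex) (auto simp: inj_on_def)
  finally show ?thesis using sum_le_half_gaussian_integral[OF l, of M] by simp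
qed

section \<open>Finite Fourier analysis\<close>

lemma pmf_indep_coordinates:
  fixes X :: "('a::countable^'n) pmf"
  assumes "prob_space.indep_vars (measure_pmf X) (\<lambda>_. count_space UNIV) (\<lambda>j x. x $ j) UNIV"
  shows "pmf X k = (\<Prod>j\<in>UNIV. measure_pmf.prob X {x. x $ j = k $ j})"
proof -
  have "measure_pmf.prob X (\<Inter>j\<in>UNIV. (\<lambda>x. x $ j) -` {k $ j} \<inter> space (measure_pmf X))
      = (\<Prod>j\<in>UNIV. measure_pmf.prob X ((\<lambda>x. x $ j) -` {k $ j} \<inter> space (measure_pmf X)))"
    using assms by (intro prob_space.indep_varsD_finite[OF prob_space_measure_pmf, where M'="\<lambda>_. count_space UNIV"]) auto
  also have "(\<Inter>j\<in>UNIV. (\<lambda>x. x $ j) -` {k $ j} \<inter> space (measure_pmf X)) = {k}"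
    by (auto simp: vec_eq_iff)
  finally show ?thesis by (simp add: measure_pmf_single vimage_def)
qed

lemma has_bochner_integral_nat_pmf_sums:
  fixes f :: "nat \<Rightarrow> 'b::{banach, second_countable_topology}"
  assumes pmf: "\<And>k. measure_pmf.prob X {x. g x = k} = w k"
    and sm: "summable (\<lambda>k. norm (w k *\<^sub>R f k))"
  shows "has_bochner_integral (measure_pmf X) (\<lambda>x. f (g x)) (\<Sum>k. w k *\<^sub>R f k)"
proof -
  have w: "pmf (map_pmf g X) k = w k" for k
    using pmf[of k] by (simp add: pmf_map vimage_def)
  have int: "integrable (count_space UNIV) (\<lambda>k. w k *\<^sub>R f k)"
    using sm by (simp add: integrable_count_space_nat_iff)
  then have "has_bochner_integral (count_space UNIV) (\<lambda>k. w k *\<^sub>R f k) (\<Sum>k. w k *\<^sub>R f k)"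
    using sums_unique[OF sums_integral_count_space_nat[OF int]] by (simp add: has_bochner_integral_iff)
  then have "has_bochner_integral (measure_pmf (map_pmf g X)) f (\<Sum>k. w k *\<^sub>R f k)"
    by (simp add: has_bochner_integral_measure_pmf_iff w)
  then show ?thesis by (simp add: has_bochner_integral_iff)
qed

lemma integrable_geometric:
  assumes "\<And>k. measure_pmf.prob X {x. g x = k} = (1 - Q) * Q ^ k" "0 \<le> Q" "Q < 1"
  shows "integrable (measure_pmf X) (\<lambda>x. real (g x))"
proof -
  have "summable (\<lambda>k. real (Suc k) * Q ^ k)"
    using geometric_deriv_sums[of Q] assms(2,3) by (simp add: sums_iff)
  then have "summable (\<lambda>k. real k * Q ^ k)"
    by (rule summable_comparison_test'[where N = 0])
       (use assms(2) in \<open>auto intro!: mult_right_mono\<close>)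
  then have "summable (\<lambda>k. (1 - Q) * (real k * Q ^ k))" by (rule summable_mult)
  then have "summable (\<lambda>k. norm (((1 - Q) * Q ^ k) *\<^sub>R real k))"
    using assms(2,3) by (simp add: mult_ac abs_mult)
  from has_bochner_integral_nat_pmf_sums[OF assms(1) this] show ?thesis
    by (simp add: has_bochner_integral_iff)
qed

text \<open>A geometric series with ratio \<open>of_real Q * cis \<theta>\<close>, whose norm is
  \<open>Q\<close>.\<close>

lemma expectation_cis_geometric:
  assumes "\<And>k. measure_pmf.prob X {x. g x = k} = (1 - Q) * Q ^ k" "0 \<le> Q" "Q < 1"
  shows "measure_pmf.expectation X (\<lambda>x. cis (\<theta> * real (g x)))
    = of_real (1 - Q) / (1 - of_real Q * cis \<theta>)"
proof -
  let ?z = "of_real Q * cis \<theta>"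
  have eq: "((1 - Q) * Q ^ k) *\<^sub>R cis (\<theta> * real k) = of_real (1 - Q) * ?z ^ k" for k
    unfolding power_mult_distrib Complex.DeMoivre by (simp add: scaleR_conv_of_real mult_ac)
  have z: "norm ?z < 1" using assms(2,3) by (simp add: norm_mult)
  have "summable (\<lambda>k. (1 - Q) * Q ^ k)"
    using assms(2,3) by (intro summable_mult summable_geometric) auto
  then have "summable (\<lambda>k. norm (((1 - Q) * Q ^ k) *\<^sub>R cis (\<theta> * real k)))"
    using assms(2,3) by (simp add: abs_mult)
  from has_bochner_integral_nat_pmf_sums[OF assms(1) this]
  have "measure_pmf.expectation X (\<lambda>x. cis (\<theta> * real (g x))) = (\<Sum>k. of_real (1 - Q) * ?z ^ k)"
    unfolding eq by (simp add: has_bochner_integral_iff)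
  also have "\<dots> = of_real (1 - Q) * (\<Sum>k. ?z ^ k)"
    using z by (intro suminf_mult summable_geometric)
  also have "\<dots> = of_real (1 - Q) / (1 - ?z)"
    using z by (simp add: suminf_geometric)
  finally show ?thesis .
qed

text \<open>The squared norm of the denominator is
  \<open>(1 - Q)\<^sup>2 + 2 * Q * (1 - cos \<theta>)\<close>; division by
  \<open>(1 - Q)\<^sup>2\<close> produces the parameter \<open>\<alpha>\<close> of the
  theorem.\<close>

lemma norm_geometric_char:
  fixes Q \<theta> :: real
  assumes "0 \<le> Q" "Q < 1"
  shows "norm (of_real (1 - Q) / (1 - of_real Q * cis \<theta>))
    = (1 + 2 * Q / (1 - Q)\<^sup>2 * (1 - cos \<theta>)) powr (- 1 / 2)"
proof -
  let ?D = "1 + 2 * Q / (1 - Q)\<^sup>2 * (1 - cos \<theta>)"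
  have "(norm (1 - of_real Q * cis \<theta>))\<^sup>2 = (1 - Q * cos \<theta>)\<^sup>2 + (Q * sin \<theta>)\<^sup>2"
    by (simp add: cmod_power2)
  also have "\<dots> = 1 - 2 * Q * cos \<theta> + Q\<^sup>2 * ((sin \<theta>)\<^sup>2 + (cos \<theta>)\<^sup>2)"
    by (simp add: power2_eq_square algebra_simps del: sin_cos_squared_add sin_cos_squared_add2 sin_cos_squared_add3)
  also have "\<dots> = (1 - Q)\<^sup>2 + 2 * Q * (1 - cos \<theta>)"
    by (simp add: power2_eq_square algebra_simps)
  also have "\<dots> = (1 - Q)\<^sup>2 * ?D"
    using assms by (simp add: distrib_left)
  finally have sq: "(norm (1 - of_real Q * cis \<theta>))\<^sup>2 = (1 - Q)\<^sup>2 * ?D" .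
  have D: "?D > 0" using assms by (auto intro!: add_pos_nonneg mult_nonneg_nonneg divide_nonneg_nonneg)
  have "norm (1 - of_real Q * cis \<theta>) = sqrt ((1 - Q)\<^sup>2 * ?D)"
    unfolding sq[symmetric] by simp
  also have "\<dots> = (1 - Q) * sqrt ?D"
    using assms by (simp add: real_sqrt_mult)
  finally have "norm (of_real (1 - Q) / (1 - of_real Q * cis \<theta>)) = 1 / sqrt ?D"
    using assms by (simp add: norm_divide del: of_real_diff)
  also have "\<dots> = ?D powr (- 1 / 2)"
    using D by (simp add: powr_minus_divide powr_half_sqrt)
  finally show ?thesis .
qed

text \<open>On the support, \<open>- ln (pmf X k)\<close> is affine in the coordinates of
  \<open>k\<close>, so the entropy is a combination of finitely many finite means. This rules out
  that \<open>enn2real\<close> sends an infinite entropy to 0.\<close>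

lemma entropy_indep_geometric_finite:
  fixes X :: "(nat^'n) pmf" and Q :: "'n \<Rightarrow> real"
  assumes indep: "prob_space.indep_vars (measure_pmf X) (\<lambda>_. count_space UNIV) (\<lambda>j x. x $ j) UNIV"
    and geom: "\<And>j k. measure_pmf.prob X {x. x $ j = k} = (1 - Q j) * Q j ^ k"
    and Q: "\<And>j. 0 \<le> Q j" "\<And>j. Q j < 1"
  shows "entropy_pmf X \<noteq> \<infinity>"
proof -
  let ?g = "\<lambda>x. - (\<Sum>j\<in>UNIV. ln (1 - Q j) + real (x $ j) * ln (Q j))"
  have "integrable (measure_pmf X) ?g"
    using integrable_geometric[OF geom Q] by (auto intro!: Bochner_Integration.integrable_sum)
  then have int: "integrable (count_space UNIV) (\<lambda>k. pmf X k * ?g k)"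
    using has_bochner_integral_measure_pmf_iff[of X ?g] by (auto simp: has_bochner_integral_iff)
  have eq: "- (pmf X k * ln (pmf X k)) = pmf X k * ?g k" for k
  proof (cases "pmf X k = 0")
    case False
    have p: "pmf X k = (\<Prod>j\<in>UNIV. (1 - Q j) * Q j ^ (k $ j))"
      using pmf_indep_coordinates[OF indep, of k] by (simp add: geom)
    have pos: "(1 - Q j) * Q j ^ (k $ j) > 0" for j
    proof -
      have "(1 - Q j) * Q j ^ (k $ j) \<noteq> 0" using False unfolding p by simp
      moreover have "(1 - Q j) * Q j ^ (k $ j) \<ge> 0" using Q[of j] by simp
      ultimately show ?thesis by linarith
    qed
    have "ln (pmf X k) = (\<Sum>j\<in>UNIV. ln ((1 - Q j) * Q j ^ (k $ j)))"
      unfolding p by (intro ln_prod less_imp_neq[OF pos, THEN not_sym]) simp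
    also have "\<dots> = (\<Sum>j\<in>UNIV. ln (1 - Q j) + real (k $ j) * ln (Q j))"
    proof (rule sum.cong)
      fix j :: 'n
      show "ln ((1 - Q j) * Q j ^ (k $ j)) = ln (1 - Q j) + real (k $ j) * ln (Q j)"
      proof (cases "Q j = 0")
        case True
        \<comment> \<open>A zero parameter is harmless: positivity of the factor forces
          \<open>k $ j = 0\<close>, so \<open>ln 0\<close> gets coefficient 0.\<close>
        then have "k $ j = 0" using pos[of j] by (cases "k $ j") auto
        with True show ?thesis by simp
      next
        case False
        then have "Q j > 0" using Q(1)[of j] by linarith
        then show ?thesis using Q(2)[of j] by (simp add: ln_mult ln_realpow)
      qed
    qed simp
    finally show ?thesis by simp
  qed simp
  have "entropy_pmf X = ennreal (integral\<^sup>L (count_space UNIV) (\<lambda>k. pmf X k * ?g k))"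
    unfolding entropy_pmf_def eq
    by (intro nn_integral_eq_integral int AE_I2)
       (use neg_xlogx_nonneg[OF pmf_nonneg pmf_le_1, of X] in \<open>simp only: eq\<close>)
  then show ?thesis by simp
qed

section \<open>Characters of the finite torus\<close>

lemma prod_cis: "(\<Prod>i\<in>I. cis (f i)) = cis (\<Sum>i\<in>I. f i)"
  by (induction I rule: infinite_finite_induct) (auto simp: cis_mult)

text \<open>For \<open>w\<close> not divisible by \<open>N\<close> this is a full geometric sum over
  an \<open>N\<close>-th root of unity different from 1, hence 0.\<close>

lemma root_of_unity_sum:
  fixes w :: int and N :: nat
  assumes "N > 0"
  shows "(\<Sum>t<N. cis (2 * pi / real N * (real t * real_of_int w))) = (if int N dvd w then of_nat N else 0)"
proof -
  let ?z = "cis (2 * pi / real N * real_of_int w)"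
  have pow: "cis (2 * pi / real N * (real t * real_of_int w)) = ?z ^ t" for t
    by (simp add: Complex.DeMoivre algebra_simps)
  show ?thesis
  proof (cases "int N dvd w")
    case True
    then obtain v where "w = int N * v" by auto
    then have "2 * pi / real N * real_of_int w = 2 * pi * real_of_int v" using assms by simp
    then have "?z = 1" by (simp add: cis_multiple_2pi)
    with True show ?thesis unfolding pow by simp
  next
    case False
    have "?z \<noteq> 1"
    proof
      assume "?z = 1"
      then have "cos (2 * pi / real N * real_of_int w) = 1" by (simp add: complex_eq_iff)
      then obtain v :: int where "2 * pi / real N * real_of_int w = real_of_int v * 2 * pi"
        using cos_one_2pi_int by auto
      then have "real_of_int w = real_of_int v * real N" using assms by (simp add: field_simps)
      then have "w = v * int N" by (metis of_int_eq_iff of_int_mult of_int_of_nat_eq)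
      with False show False by simp
    qed
    moreover have "?z ^ N = 1"
    proof -
      have "?z ^ N = cis (2 * pi * real_of_int w)" using assms by (simp add: Complex.DeMoivre)
      then show ?thesis by (simp add: cis_multiple_2pi)
    qed
    ultimately show ?thesis using False unfolding pow by (simp add: geometric_sum)
  qed
qed

text \<open>Orthogonality of characters, factored over the coordinates. This sum stands in for the
  integral over the torus.\<close>

lemma torus_grid_sum:
  fixes w :: "'m::finite \<Rightarrow> int" and N :: nat
  assumes "N > 0"
  shows "(\<Sum>t\<in>UNIV \<rightarrow>\<^sub>E {..<N}. cis (2 * pi / real N * (\<Sum>i\<in>UNIV. real (t i) * real_of_int (w i))))
    = (if \<forall>i. int N dvd w i then of_nat N ^ CARD('m) else 0)"
proof -
  have "(\<Sum>t\<in>UNIV \<rightarrow>\<^sub>E {..<N}. cis (2 * pi / real N * (\<Sum>i\<in>UNIV. real (t i) * real_of_int (w i))))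
    = (\<Sum>t\<in>UNIV \<rightarrow>\<^sub>E {..<N}. \<Prod>i\<in>UNIV. cis (2 * pi / real N * (real (t i) * real_of_int (w i))))"
    by (simp add: prod_cis sum_distrib_left)
  also have "\<dots> = (\<Prod>i\<in>UNIV. \<Sum>t<N. cis (2 * pi / real N * (real t * real_of_int (w i))))"
    by (subst prod_sum_PiE) auto
  also have "\<dots> = (\<Prod>i\<in>UNIV. if int N dvd w i then of_nat N else 0)"
    by (intro prod.cong refl root_of_unity_sum assms)
  also have "\<dots> = (if \<forall>i. int N dvd w i then of_nat N ^ CARD('m) else 0)"
    by auto
  finally show ?thesis .
qed

lemma norm_expectation_cis_eq:
  fixes X :: "(nat^'n) pmf" and Q \<theta> :: "'n \<Rightarrow> real"
  assumes indep: "prob_space.indep_vars (measure_pmf X) (\<lambda>_. count_space UNIV) (\<lambda>j x. x $ j) UNIV"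
    and geom: "\<And>j k. measure_pmf.prob X {x. x $ j = k} = (1 - Q j) * Q j ^ k"
    and Q: "\<And>j. 0 \<le> Q j" "\<And>j. Q j < 1"
  shows "norm (measure_pmf.expectation X (\<lambda>x. cis (\<Sum>j\<in>UNIV. \<theta> j * real (x $ j))))
    = (\<Prod>j\<in>UNIV. (1 + 2 * Q j / (1 - Q j)\<^sup>2 * (1 - cos (\<theta> j))) powr (- 1 / 2))"
proof -
  have "measure_pmf.expectation X (\<lambda>x. cis (\<Sum>j\<in>UNIV. \<theta> j * real (x $ j)))
      = measure_pmf.expectation X (\<lambda>x. \<Prod>j\<in>UNIV. cis (\<theta> j * real (x $ j)))"
    by (simp add: prod_cis)
  also have "\<dots> = (\<Prod>j\<in>UNIV. measure_pmf.expectation X (\<lambda>x. cis (\<theta> j * real (x $ j))))"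
    by (intro prob_space.indep_vars_lebesgue_integral[OF prob_space_measure_pmf] prob_space.indep_vars_compose2[OF prob_space_measure_pmf indep]
         measure_pmf.integrable_const_bound[where B = 1]) auto
  also have "\<dots> = (\<Prod>j\<in>UNIV. of_real (1 - Q j) / (1 - of_real (Q j) * cis (\<theta> j)))"
    by (intro prod.cong refl expectation_cis_geometric geom Q)
  finally show ?thesis
    by (simp only: prod_norm[symmetric] norm_geometric_char[OF Q])
qed

text \<open>The character sum equals \<open>N ^ CARD('m)\<close> at every \<open>x\<close> with the
  same image as \<open>x0\<close> and is nonnegative elsewhere. It thus dominates the indicator, and
  the triangle inequality bounds its expectation by the norms of the characteristic
  function.\<close>

lemma prob_linear_image_le_grid_sum:
  fixes A :: "real^'n^'m" and X :: "(nat^'n) pmf" and Q :: "'n \<Rightarrow> real" and N :: nat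
  assumes A: "\<forall>i j. A $ i $ j \<in> \<int>"
    and indep: "prob_space.indep_vars (measure_pmf X) (\<lambda>_. count_space UNIV) (\<lambda>j x. x $ j) UNIV"
    and geom: "\<And>j k. measure_pmf.prob X {x. x $ j = k} = (1 - Q j) * Q j ^ k"
    and Q: "\<And>j. 0 \<le> Q j" "\<And>j. Q j < 1"
    and N: "N > 0"
  shows "real N ^ CARD('m) * measure_pmf.prob X {x. A *v real_vec x = A *v real_vec x0}
    \<le> (\<Sum>t\<in>UNIV \<rightarrow>\<^sub>E {..<N}. \<Prod>j\<in>UNIV. (1 + 2 * Q j / (1 - Q j)\<^sup>2 *
         (1 - cos (2 * pi / real N * (\<Sum>i\<in>UNIV. A $ i $ j * real (t i))))) powr (- 1 / 2))"
proof -
  let ?T = "UNIV \<rightarrow>\<^sub>E {..<N} :: ('m \<Rightarrow> nat) set"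
  define \<theta> where "\<theta> = (\<lambda>t j. 2 * pi / real N * (\<Sum>i\<in>UNIV. A $ i $ j * real (t i)))"
  define \<phi> where "\<phi> = (\<lambda>t x. cis (\<Sum>j\<in>UNIV. \<theta> t j * (real (x $ j) - real (x0 $ j))))"
  have finT: "finite ?T" by (intro finite_PiE) auto
  from A have "\<forall>i. \<forall>j. \<exists>z. A $ i $ j = real_of_int z" by (auto elim!: Ints_cases)
  then obtain Z where Z: "\<And>i j. A $ i $ j = real_of_int (Z i j)" by metis
  define w where "w = (\<lambda>x i. \<Sum>j\<in>UNIV. Z i j * (int (x $ j) - int (x0 $ j)))"
  have w: "real_of_int (w x i) = (A *v real_vec x) $ i - (A *v real_vec x0) $ i" for x i
    by (simp add: w_def Z matrix_vector_mult_def real_vec_def algebra_simps sum_subtractf)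
  have arg: "(\<Sum>j\<in>UNIV. \<theta> t j * (real (x $ j) - real (x0 $ j)))
      = 2 * pi / real N * (\<Sum>i\<in>UNIV. real (t i) * real_of_int (w x i))" for t x
    unfolding \<theta>_def w_def of_int_sum sum_distrib_left sum_distrib_right
    by (subst sum.swap) (simp add: Z algebra_simps diff_divide_distrib)
  \<comment> \<open>Only an inequality: points whose images agree with that of \<open>x0\<close>
    merely modulo \<open>N\<close> contribute as well.\<close>
  have ind: "real N ^ CARD('m) * indicator {x. A *v real_vec x = A *v real_vec x0} x \<le> Re (\<Sum>t\<in>?T. \<phi> t x)" for x
  proof -
    have "(\<Sum>t\<in>?T. \<phi> t x) = (if \<forall>i. int N dvd w x i then of_nat N ^ CARD('m) else 0)"
      unfolding \<phi>_def arg by (rule torus_grid_sum[OF N])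
    moreover have "\<forall>i. w x i = 0" if "A *v real_vec x = A *v real_vec x0"
    proof
      fix i show "w x i = 0" using w[of x i] that by simp
    qed
    ultimately show ?thesis by (auto simp: indicator_def simp flip: of_nat_power)
  qed
  have int\<phi>: "integrable (measure_pmf X) (\<phi> t)" for t
    by (rule measure_pmf.integrable_const_bound[where B = 1]) (auto simp: \<phi>_def)
  have "real N ^ CARD('m) * measure_pmf.prob X {x. A *v real_vec x = A *v real_vec x0}
     = measure_pmf.expectation X (\<lambda>x. real N ^ CARD('m) * indicator {x. A *v real_vec x = A *v real_vec x0} x)"
    by simp
  also have "\<dots> \<le> measure_pmf.expectation X (\<lambda>x. Re (\<Sum>t\<in>?T. \<phi> t x))"
  proof (rule integral_mono)
    show "integrable (measure_pmf X) (\<lambda>x. Re (\<Sum>t\<in>?T. \<phi> t x))"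
      using int\<phi> by (intro integrable_Re Bochner_Integration.integrable_sum)
    show "integrable (measure_pmf X) (\<lambda>x. real N ^ CARD('m) * indicator {x. A *v real_vec x = A *v real_vec x0} x)"
      by (rule measure_pmf.integrable_const_bound[where B = "real N ^ CARD('m)"])
         (auto simp: indicator_def)
  qed (rule ind)
  also have "\<dots> = Re (\<Sum>t\<in>?T. measure_pmf.expectation X (\<phi> t))"
    using int\<phi> by (subst integral_Re) (auto intro!: Bochner_Integration.integrable_sum)
  also have "\<dots> \<le> norm (\<Sum>t\<in>?T. measure_pmf.expectation X (\<phi> t))" by (rule complex_Re_le_cmod)
  also have "\<dots> \<le> (\<Sum>t\<in>?T. norm (measure_pmf.expectation X (\<phi> t)))" by (rule norm_sum)
  also have "\<dots> = (\<Sum>t\<in>?T. \<Prod>j\<in>UNIV. (1 + 2 * Q j / (1 - Q j)\<^sup>2 * (1 - cos (\<theta> t j))) powr (- 1 / 2))"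
  proof (rule sum.cong)
    fix t
    \<comment> \<open>The centre \<open>x0\<close> enters only through a phase of modulus 1.\<close>
    have "\<phi> t = (\<lambda>x. cis (- (\<Sum>j\<in>UNIV. \<theta> t j * real (x0 $ j))) * cis (\<Sum>j\<in>UNIV. \<theta> t j * real (x $ j)))"
      by (simp add: \<phi>_def cis_mult algebra_simps sum_subtractf)
    then have "norm (measure_pmf.expectation X (\<phi> t))
       = norm (measure_pmf.expectation X (\<lambda>x. cis (\<Sum>j\<in>UNIV. \<theta> t j * real (x $ j))))"
      by (simp add: norm_mult)
    then show "norm (measure_pmf.expectation X (\<phi> t)) = (\<Prod>j\<in>UNIV. (1 + 2 * Q j / (1 - Q j)\<^sup>2 * (1 - cos (\<theta> t j))) powr (- 1 / 2))"
      using norm_expectation_cis_eq[OF indep geom Q] by simp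
  qed simp
  finally show ?thesis by (simp add: \<theta>_def)
qed

section \<open>Blocks of columns\<close>

lemma det_Ints:
  fixes B :: "real^'m^'m"
  assumes "\<And>i j. B $ i $ j \<in> \<int>"
  shows "det B \<in> \<int>"
  unfolding det_def using assms by (intro Ints_sum Ints_mult Ints_prod Ints_of_int)

text \<open>Injectivity lets independence of the set of rows be read as independence of the family;
  a repeated row would otherwise go unnoticed.\<close>

lemma det_nonzero_if_independent_rows:
  fixes B :: "real^'m^'m"
  assumes inj: "inj (\<lambda>r. row r B)" and ind: "independent (range (\<lambda>r. row r B))"
  shows "det B \<noteq> 0"
proof -
  have "c i = 0" if "(\<Sum>i\<in>UNIV. c i *s row i B) = 0" for c i
  proof -
    let ?f = "\<lambda>r. row r B"
    have "(\<Sum>v\<in>range ?f. c (inv ?f v) *\<^sub>R v) = (\<Sum>i\<in>UNIV. c i *\<^sub>R row i B)"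
      by (subst sum.reindex) (auto simp: inj inv_f_f[OF inj])
    also have "\<dots> = 0" using that by (simp add: scalar_mult_eq_scaleR)
    finally have "c (inv ?f (?f i)) = 0"
      using ind by (intro independentD[where t = "range ?f"]) auto
    then show ?thesis by (simp add: inv_f_f[OF inj])
  qed
  then have "\<exists>B'. B ** B' = mat 1" by (subst matrix_right_invertible_independent_rows) blast
  then have "invertible B" by (simp add: invertible_right_inverse)
  then show ?thesis by (simp add: invertible_det_nz)
qed

text \<open>Let \<open>?y\<close> be \<open>x\<close> divided by \<open>N\<close>. Then
  \<open>?B *v ?y\<close> is integral, and by Cramer's rule \<open>?y $ k * det ?B\<close> is the
  determinant of an integer matrix. Hence \<open>N\<close> divides \<open>x k * d\<close>, and
  \<open>d\<close> is coprime to \<open>N\<close>.\<close>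

lemma int_matrix_inj_mod:
  fixes Z :: "'m::finite \<Rightarrow> 'm \<Rightarrow> int" and x :: "'m \<Rightarrow> int"
  assumes det: "det (\<chi> r i. real_of_int (Z r i)) = real_of_int d" and cop: "coprime d N" and N: "N \<noteq> 0"
    and dvd: "\<And>r. N dvd (\<Sum>i\<in>UNIV. Z r i * x i)"
  shows "N dvd x k"
proof -
  let ?B = "(\<chi> r i. real_of_int (Z r i)) :: real^'m^'m"
  let ?y = "(\<chi> i. real_of_int (x i) / real_of_int N) :: real^'m"
  have y: "(?B *v ?y) $ r \<in> \<int>" for r
  proof -
    obtain u where "(\<Sum>i\<in>UNIV. Z r i * x i) = N * u" using dvd[of r] by blast
    then have "(\<Sum>i\<in>UNIV. real_of_int (Z r i) * real_of_int (x i)) = real_of_int N * real_of_int u"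
      by (metis (no_types, lifting) of_int_mult of_int_sum sum.cong)
    then have "(?B *v ?y) $ r = real_of_int u"
      using N by (simp add: matrix_vector_mult_def field_simps flip: sum_divide_distrib)
    then show ?thesis by simp
  qed
  have "det ((\<chi> i j. if j = k then (?B *v ?y) $ i else ?B $ i $ j) :: real^'m^'m) \<in> \<int>"
    by (rule det_Ints) (use y in auto)
  then have "?y $ k * det ?B \<in> \<int>" by (subst (asm) cramer_lemma)
  then obtain v where "real_of_int (x k) / real_of_int N * real_of_int d = real_of_int v"
    by (auto simp: det elim!: Ints_cases)
  then have "real_of_int (x k * d) = real_of_int (N * v)" using N by (simp add: field_simps)
  then have "x k * d = N * v" by (simp only: of_int_eq_iff)
  then have "N dvd x k * d" by simp
  then show ?thesis using cop by (simp add: coprime_commute coprime_dvd_mult_left_iff)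
qed

text \<open>\<open>B\<close> acts injectively, hence bijectively, on residue vectors modulo
  \<open>N\<close>. Periodicity permits the centred representatives from \<open>- M\<close> to
  \<open>M\<close>, after which each factor depends on a variable of its own.\<close>

lemma torus_grid_sum_reindex:
  fixes B :: "real^'m^'m" and G :: "'m \<Rightarrow> real \<Rightarrow> real"
  assumes B: "\<And>r i. B $ r $ i \<in> \<int>" and det: "det B = real_of_int d"
    and N: "N = 2 * M + 1" and cop: "coprime d (int N)"
    and per: "\<And>r x k. G r (x + 2 * pi * real_of_int k) = G r x"
  shows "(\<Sum>t\<in>UNIV \<rightarrow>\<^sub>E {..<N}. \<Prod>r\<in>UNIV. G r (2 * pi / real N * (\<Sum>i\<in>UNIV. B $ r $ i * real (t i))))
    = (\<Sum>s\<in>UNIV \<rightarrow>\<^sub>E {- int M..int M}. \<Prod>r\<in>UNIV. G r (2 * pi / real N * real_of_int (s r)))"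
proof -
  let ?T = "UNIV \<rightarrow>\<^sub>E {..<N} :: ('m \<Rightarrow> nat) set"
  let ?S = "UNIV \<rightarrow>\<^sub>E {- int M..int M} :: ('m \<Rightarrow> int) set"
  from B have "\<forall>r. \<forall>i. \<exists>z. B $ r $ i = real_of_int z" by (auto elim!: Ints_cases)
  then obtain Z where Z: "\<And>r i. B $ r $ i = real_of_int (Z r i)" by metis
  define y where "y = (\<lambda>t r. \<Sum>i\<in>UNIV. Z r i * int (t i))"
  \<comment> \<open>Shifting by \<open>M\<close> before the reduction and back afterwards selects
    the centred residue.\<close>
  define h where "h = (\<lambda>t r. (y t r + int M) mod int N - int M)"
  have N0: "N > 0" using N by simp
  have Beq: "B = (\<chi> r i. real_of_int (Z r i))" by (simp add: vec_eq_iff Z)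
  have "inj_on h ?T"
  proof (rule inj_onI)
    fix t t' assume t: "t \<in> ?T" "t' \<in> ?T" and eq: "h t = h t'"
    have "int N dvd (\<Sum>i\<in>UNIV. Z r i * (int (t i) - int (t' i)))" for r
    proof -
      have "(y t r + int M) mod int N = (y t' r + int M) mod int N"
        using fun_cong[OF eq, of r] by (simp add: h_def)
      then have "int N dvd (y t r + int M) - (y t' r + int M)" by (simp add: mod_eq_dvd_iff)
      then show ?thesis by (simp add: y_def algebra_simps sum_subtractf)
    qed
    then have dvd: "int N dvd int (t k) - int (t' k)" for k
      using int_matrix_inj_mod[of Z d "int N" "\<lambda>i. int (t i) - int (t' i)" k] det cop N0 by (simp add: Beq)
    show "t = t'"
    proof
      fix k
      have "t k < N" "t' k < N" using t by auto
      then have "int (t k) mod int N = int (t k)" "int (t' k) mod int N = int (t' k)" by auto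
      with dvd[of k] show "t k = t' k" by (simp add: mod_eq_dvd_iff[symmetric])
    qed
  qed
  moreover have "h ` ?T \<subseteq> ?S"
  proof (clarsimp simp: PiE_def Pi_def)
    fix t r
    have "0 \<le> (y t r + int M) mod int N" "(y t r + int M) mod int N < int N" using N0 by auto
    moreover have "int N = 2 * int M + 1" using N by simp
    ultimately show "- int M \<le> h t r \<and> h t r \<le> int M" unfolding h_def by linarith
  qed
  moreover have "card ?S = card ?T" by (simp add: card_PiE N nat_add_distrib nat_mult_distrib)
  moreover have "finite ?S" by (intro finite_PiE) auto
  ultimately have bij: "bij_betw h ?T ?S"
    by (simp add: bij_betw_def card_image card_subset_eq)
  have G: "G r (2 * pi / real N * (\<Sum>i\<in>UNIV. B $ r $ i * real (t i))) = G r (2 * pi / real N * real_of_int (h t r))" for t r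
  proof -
    have "y t r = h t r + int N * ((y t r + int M) div int N)"
      unfolding h_def using mult_div_mod_eq[of "int N" "y t r + int M"] by linarith
    then have "real_of_int (y t r) = real_of_int (h t r) + real N * real_of_int ((y t r + int M) div int N)"
      by (metis of_int_add of_int_mult of_int_of_nat_eq)
    then have "2 * pi / real N * real_of_int (y t r)
       = 2 * pi / real N * real_of_int (h t r) + 2 * pi * real_of_int ((y t r + int M) div int N)"
      using N0 by (simp add: field_simps)
    moreover have "(\<Sum>i\<in>UNIV. B $ r $ i * real (t i)) = real_of_int (y t r)"
      by (simp add: y_def Z)
    ultimately show ?thesis by (simp only: per)
  qed
  show ?thesis unfolding G
    by (rule sum.reindex_bij_betw[OF bij, of "\<lambda>s. \<Prod>r\<in>UNIV. G r (2 * pi / real N * real_of_int (s r))"])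
qed

section \<open>Bounds for sums over the grid\<close>

text \<open>Either every factor is below its Gaussian, or one factor is at most
  \<open>C' ^ p\<close> while all others are at most 1. The sum covers both cases.\<close>

lemma prod_cos_factor_le:
  fixes a c :: "'m::finite \<Rightarrow> real" and p :: nat
  assumes a: "\<And>r. 0 < a r" and \<gamma>: "0 < \<gamma>"
    and c: "\<And>r. c r = max (1 / \<gamma>\<^sup>2 * ln (1 + a r * (1 - cos (\<gamma> / sqrt (a r))))) (1 / (a r * pi\<^sup>2) * ln (1 + 2 * a r))"
    and C': "\<And>r. exp (- (\<gamma>\<^sup>2 * c r / 2)) \<le> C'"
    and \<theta>: "\<And>r. \<bar>\<theta> r\<bar> \<le> pi"
  shows "(\<Prod>r\<in>UNIV. (1 + a r * (1 - cos (\<theta> r))) powr (- real p / 2))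
    \<le> (\<Prod>r\<in>UNIV. exp (- (real p * c r * a r / 2 * (\<theta> r)\<^sup>2))) + C' ^ p"
proof -
  let ?f = "\<lambda>r. (1 + a r * (1 - cos (\<theta> r))) powr (- real p / 2)"
  have C'0: "0 \<le> C'" using C' exp_ge_zero order_trans by blast
  show ?thesis
  proof (cases "\<forall>r. ?f r \<le> exp (- (real p * c r * a r / 2 * (\<theta> r)\<^sup>2))")
    case True
    then have "prod ?f UNIV \<le> (\<Prod>r\<in>UNIV. exp (- (real p * c r * a r / 2 * (\<theta> r)\<^sup>2)))"
      by (intro prod_mono) auto
    then show ?thesis using C'0 by (simp add: add_increasing2)
  next
    case False
    then obtain r where "\<not> ?f r \<le> exp (- (real p * c r * a r / 2 * (\<theta> r)\<^sup>2))" by blast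
    then have "?f r \<le> exp (- (\<gamma>\<^sup>2 * c r / 2)) ^ p"
      using cos_factor_power_le[OF a[of r] \<gamma> c[of r] \<theta>[of r], of p] by blast
    also have "\<dots> \<le> C' ^ p" using C' by (intro power_mono) auto
    finally have fr: "?f r \<le> C' ^ p" .
    have le1: "?f s \<le> 1" for s
    proof -
      have "1 + a s * (1 - cos (\<theta> s)) \<ge> 1" using a[of s] by (simp add: mult_nonneg_nonneg)
      then have "(1 + a s * (1 - cos (\<theta> s))) powr (- real p / 2) \<le> (1 + a s * (1 - cos (\<theta> s))) powr 0"
        by (intro powr_mono) auto
      then show ?thesis using \<open>1 + a s * (1 - cos (\<theta> s)) \<ge> 1\<close> by simp
    qed
    have "prod ?f UNIV = ?f r * prod ?f (UNIV - {r})" by (rule prod.remove) auto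
    also have "\<dots> \<le> ?f r * 1" using le1 by (intro mult_left_mono prod_le_1) auto
    finally have "prod ?f UNIV \<le> C' ^ p" using fr by simp
    moreover have "0 \<le> (\<Prod>r\<in>UNIV. exp (- (real p * c r * a r / 2 * (\<theta> r)\<^sup>2)))" by (intro prod_nonneg) auto
    ultimately show ?thesis by linarith
  qed
qed

text \<open>The Gaussian part factors into one-dimensional sums, and the constant
  \<open>C' ^ p\<close> is counted once for each of the \<open>N ^ CARD('m)\<close> grid
  points.\<close>

lemma grid_sum_cos_factor_le:
  fixes a c :: "'m::finite \<Rightarrow> real" and p :: nat
  assumes a: "\<And>r. 0 < a r" and \<gamma>: "0 < \<gamma>"
    and c: "\<And>r. c r = max (1 / \<gamma>\<^sup>2 * ln (1 + a r * (1 - cos (\<gamma> / sqrt (a r))))) (1 / (a r * pi\<^sup>2) * ln (1 + 2 * a r))"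
    and C': "\<And>r. exp (- (\<gamma>\<^sup>2 * c r / 2)) \<le> C'"
    and p: "p > 0" and N: "N = 2 * M + 1"
  shows "(\<Sum>s\<in>UNIV \<rightarrow>\<^sub>E {- int M..int M}. \<Prod>r\<in>UNIV.
        (1 + a r * (1 - cos (2 * pi / real N * real_of_int (s r)))) powr (- real p / 2))
    \<le> (\<Prod>r\<in>UNIV. 1 + real N * (2 * pi * real p * c r * a r) powr (- 1 / 2)) + real N ^ CARD('m) * C' ^ p"
proof -
  let ?S = "UNIV \<rightarrow>\<^sub>E {- int M..int M} :: ('m \<Rightarrow> int) set"
  let ?\<theta> = "\<lambda>s r. 2 * pi / real N * real_of_int (s r)"
  have cpos: "c r > 0" for r
  proof -
    have "0 < 1 / (a r * pi\<^sup>2) * ln (1 + 2 * a r)" using a[of r] by simp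
    then show ?thesis by (simp add: c)
  qed
  have "(\<Sum>s\<in>?S. \<Prod>r\<in>UNIV. (1 + a r * (1 - cos (?\<theta> s r))) powr (- real p / 2))
     \<le> (\<Sum>s\<in>?S. (\<Prod>r\<in>UNIV. exp (- (real p * c r * a r / 2 * (?\<theta> s r)\<^sup>2))) + C' ^ p)"
  proof (intro sum_mono prod_cos_factor_le[where \<gamma> = \<gamma>] a \<gamma> c C')
    fix s r assume "s \<in> ?S"
    then have "s r \<in> {- int M..int M}" by (rule PiE_mem) simp
    then have "\<bar>s r\<bar> \<le> int M" by auto
    \<comment> \<open>Centred residues stay below \<open>N / 2\<close>, so the angles remain in the
      range of the one-variable estimate.\<close>
    then have "2 * \<bar>real_of_int (s r)\<bar> \<le> real N" unfolding N by linarith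
    then have "pi * (2 * \<bar>real_of_int (s r)\<bar>) \<le> pi * real N" by (intro mult_left_mono) auto
    then have "2 * pi / real N * \<bar>real_of_int (s r)\<bar> \<le> pi" using N
      by (simp add: divide_le_eq mult_ac del: of_nat_add of_nat_Suc)
    then show "\<bar>?\<theta> s r\<bar> \<le> pi" by (simp add: abs_mult)
  qed
  also have "\<dots> = (\<Sum>s\<in>?S. \<Prod>r\<in>UNIV. exp (- (real p * c r * a r / 2 * (?\<theta> s r)\<^sup>2))) + real N ^ CARD('m) * C' ^ p"
    by (simp add: sum.distrib card_PiE N nat_add_distrib nat_mult_distrib add_ac)
  also have "(\<Sum>s\<in>?S. \<Prod>r\<in>UNIV. exp (- (real p * c r * a r / 2 * (?\<theta> s r)\<^sup>2)))
     = (\<Prod>r\<in>UNIV. \<Sum>s\<in>{- int M..int M}. exp (- (real p * c r * a r / 2 * (2 * pi / real N * real_of_int s)\<^sup>2)))"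
    by (subst prod_sum_PiE) auto
  also have "\<dots> \<le> (\<Prod>r\<in>UNIV. 1 + real N * (2 * pi * real p * c r * a r) powr (- 1 / 2))"
  proof (intro prod_mono conjI sum_nonneg)
    fix r :: 'm
    define l where "l = real p * c r * a r / 2 * (2 * pi / real N)\<^sup>2"
    have q: "2 * pi * real p * c r * a r > 0" using a cpos p by simp
    have l: "l > 0" using a cpos p N by (simp add: l_def)
    have "(\<Sum>s\<in>{- int M..int M}. exp (- (l * (real_of_int s)\<^sup>2))) \<le> 1 + sqrt (pi / l)"
      using l by (rule symmetric_gaussian_sum_le)
    \<comment> \<open>\<open>l\<close> contains the square of the grid spacing
      \<open>2 * pi / N\<close>, which is where the factor \<open>N\<close> in the result comes
      from.\<close>
    also have "pi / l = (real N)\<^sup>2 / (2 * pi * real p * c r * a r)"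
      using a[of r] cpos[of r] p N by (simp add: l_def field_simps power2_eq_square)
    also have "sqrt \<dots> = real N * (2 * pi * real p * c r * a r) powr (- 1 / 2)"
      using q by (simp add: powr_minus_divide powr_half_sqrt real_sqrt_divide)
    finally show "(\<Sum>s\<in>{- int M..int M}. exp (- (real p * c r * a r / 2 * (2 * pi / real N * real_of_int s)\<^sup>2)))
       \<le> 1 + real N * (2 * pi * real p * c r * a r) powr (- 1 / 2)"
      by (simp add: l_def power_mult_distrib mult_ac power_divide)
  qed simp
  finally show ?thesis by simp
qed

text \<open>The inequality of arithmetic and geometric means, applied to the powers
  \<open>F k ^ card K\<close>. It takes the place of Hoelder's inequality for the blocks and turns
  the exponent \<open>- 1 / 2\<close> into \<open>- p / 2\<close>.\<close>

lemma prod_le_mean_power: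
  fixes F :: "'a \<Rightarrow> real"
  assumes "finite K" "K \<noteq> {}" "\<And>k. k \<in> K \<Longrightarrow> F k \<ge> 0"
  shows "(\<Prod>k\<in>K. F k) \<le> (\<Sum>k\<in>K. F k ^ card K) / real (card K)"
proof -
  have K: "card K > 0" using assms by (simp add: card_gt_0_iff)
  have nn: "(\<Prod>k\<in>K. F k) \<ge> 0" using assms by (intro prod_nonneg) auto
  have "(\<Prod>k\<in>K. F k) = ((\<Prod>k\<in>K. F k) ^ card K) powr (1 / real (card K))"
  proof (cases "(\<Prod>k\<in>K. F k) = 0")
    case False
    with nn have "(\<Prod>k\<in>K. F k) > 0" by simp
    then show ?thesis using K by (simp add: powr_powr flip: powr_realpow)
  qed (use K in simp)
  also have "\<dots> = (\<Prod>k\<in>K. F k ^ card K) powr (1 / real (card K))"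
    by (simp add: prod_power_distrib)
  also have "\<dots> \<le> (\<Sum>k\<in>K. F k ^ card K / real (card K))"
    using assms by (intro arith_geom_mean) auto
  finally show ?thesis by (simp add: sum_divide_distrib)
qed

text \<open>After the passage to the mean of \<open>p\<close>-th powers, each block is decoupled by
  its own permutation of the grid. All blocks obey the same bound because \<open>a\<close> does not
  depend on \<open>k\<close>, so their mean obeys it too.\<close>

lemma block_grid_sum_le:
  fixes A :: "real^'n^'m" and E :: "nat \<Rightarrow> 'm \<Rightarrow> 'n" and \<beta> :: "'n \<Rightarrow> real"
    and a c :: "'m \<Rightarrow> real" and d :: "nat \<Rightarrow> int" and p :: nat
  assumes A: "\<forall>i j. A $ i $ j \<in> \<int>"
    and E: "bij_betw (\<lambda>(k, r). E k r) ({1..p} \<times> UNIV) UNIV"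
    and \<beta>: "\<And>k r. k \<in> {1..p} \<Longrightarrow> a r \<le> \<beta> (E k r)"
    and det: "\<And>k. k \<in> {1..p} \<Longrightarrow> det ((\<chi> r i. A $ i $ E k r) :: real^'m^'m) = real_of_int (d k)"
    and cop: "\<And>k. k \<in> {1..p} \<Longrightarrow> coprime (d k) (int N)"
    and a: "\<And>r. 0 < a r" and \<gamma>: "0 < \<gamma>"
    and c: "\<And>r. c r = max (1 / \<gamma>\<^sup>2 * ln (1 + a r * (1 - cos (\<gamma> / sqrt (a r))))) (1 / (a r * pi\<^sup>2) * ln (1 + 2 * a r))"
    and C': "\<And>r. exp (- (\<gamma>\<^sup>2 * c r / 2)) \<le> C'"
    and p: "p > 0" and N: "N = 2 * M + 1"
  shows "(\<Sum>t\<in>UNIV \<rightarrow>\<^sub>E {..<N}. \<Prod>j\<in>UNIV.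
      (1 + \<beta> j * (1 - cos (2 * pi / real N * (\<Sum>i\<in>UNIV. A $ i $ j * real (t i))))) powr (- 1 / 2))
    \<le> (\<Prod>r\<in>UNIV. 1 + real N * (2 * pi * real p * c r * a r) powr (- 1 / 2)) + real N ^ CARD('m) * C' ^ p"
    (is "_ \<le> ?R")
proof -
  let ?T = "UNIV \<rightarrow>\<^sub>E {..<N} :: ('m \<Rightarrow> nat) set"
  define u where "u = (\<lambda>t j. 1 - cos (2 * pi / real N * (\<Sum>i\<in>UNIV. A $ i $ j * real (t i))))"
  define F where "F = (\<lambda>k t. \<Prod>r\<in>UNIV. (1 + a r * u t (E k r)) powr (- 1 / 2))"
  have u: "u t j \<ge> 0" for t j by (simp add: u_def)
  have pos: "1 + a r * u t j > 0" for r t j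
    using a[of r] u[of t j] by (intro add_pos_nonneg mult_nonneg_nonneg) auto
  have block: "(\<Sum>t\<in>?T. F k t ^ p) \<le> ?R" if k: "k \<in> {1..p}" for k
  proof -
    let ?B = "(\<chi> r i. A $ i $ E k r) :: real^'m^'m"
    have "(\<Sum>t\<in>?T. F k t ^ p) = (\<Sum>t\<in>?T. \<Prod>r\<in>UNIV. (1 + a r * u t (E k r)) powr (- real p / 2))"
      using pos by (simp add: F_def prod_power_distrib powr_power less_imp_neq[OF pos, THEN not_sym])
    also have "\<dots> = (\<Sum>t\<in>?T. \<Prod>r\<in>UNIV. (\<lambda>r x. (1 + a r * (1 - cos x)) powr (- real p / 2)) r
        (2 * pi / real N * (\<Sum>i\<in>UNIV. ?B $ r $ i * real (t i))))"
      by (simp add: u_def)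
    also have "\<dots> = (\<Sum>s\<in>UNIV \<rightarrow>\<^sub>E {- int M..int M}. \<Prod>r\<in>UNIV.
        (\<lambda>r x. (1 + a r * (1 - cos x)) powr (- real p / 2)) r (2 * pi / real N * real_of_int (s r)))"
    proof (rule torus_grid_sum_reindex[OF _ det[OF k] N cop[OF k]])
      fix x :: real and z :: int
      have "cos (x + 2 * pi * real_of_int z) = cos x"
        by (simp add: cos_add)
      then show "(1 + a r * (1 - cos (x + 2 * pi * real_of_int z))) powr (- real p / 2)
          = (1 + a r * (1 - cos x)) powr (- real p / 2)" for r by simp
    qed (use A in simp)
    also have "\<dots> \<le> ?R" by (rule grid_sum_cos_factor_le[OF a \<gamma> c C' p N])
    finally show ?thesis .
  qed
  have "(\<Sum>t\<in>?T. \<Prod>j\<in>UNIV. (1 + \<beta> j * u t j) powr (- 1 / 2)) \<le> (\<Sum>t\<in>?T. (\<Sum>k\<in>{1..p}. F k t ^ p) / real p)"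
  proof (rule sum_mono)
    fix t
    have "(\<Prod>j\<in>UNIV. (1 + \<beta> j * u t j) powr (- 1 / 2))
       = (\<Prod>(k, r)\<in>{1..p} \<times> UNIV. (1 + \<beta> (E k r) * u t (E k r)) powr (- 1 / 2))"
      by (subst prod.reindex_bij_betw[OF E, symmetric]) (simp add: case_prod_beta)
    also have "\<dots> = (\<Prod>k\<in>{1..p}. \<Prod>r\<in>UNIV. (1 + \<beta> (E k r) * u t (E k r)) powr (- 1 / 2))"
      by (simp add: prod.cartesian_product)
    \<comment> \<open>The exponent is negative, so replacing \<open>\<beta>\<close> by the smaller
      \<open>a\<close> enlarges each factor.\<close>
    also have "\<dots> \<le> (\<Prod>k\<in>{1..p}. F k t)"
      unfolding F_def
      using \<beta> u pos by (intro prod_mono conjI prod_nonneg powr_mono2' add_left_mono mult_right_mono) auto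
    also have "\<dots> \<le> (\<Sum>k\<in>{1..p}. F k t ^ p) / real p"
    proof -
      have "F k t \<ge> 0" for k by (simp add: F_def prod_nonneg)
      then show ?thesis using prod_le_mean_power[of "{1..p}" "\<lambda>k. F k t"] p by simp
    qed
    finally show "(\<Prod>j\<in>UNIV. (1 + \<beta> j * u t j) powr (- 1 / 2)) \<le> (\<Sum>k\<in>{1..p}. F k t ^ p) / real p" .
  qed
  also have "\<dots> = (\<Sum>k\<in>{1..p}. \<Sum>t\<in>?T. F k t ^ p) / real p"
    by (subst sum.swap) (simp add: sum_divide_distrib)
  also have "\<dots> \<le> (\<Sum>k\<in>{1..p}. ?R) / real p"
    using block by (intro divide_right_mono sum_mono) auto
  also have "\<dots> = ?R" using p by simp
  finally show ?thesis by (simp only: u_def)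
qed

text \<open>Division of the grid bound by \<open>N ^ CARD('m)\<close> leaves an error
  \<open>1 / N\<close> in each factor, which vanishes in the limit.\<close>

lemma prob_linear_image_le:
  fixes A :: "real^'n^'m" and X :: "(nat^'n) pmf" and Q :: "'n \<Rightarrow> real"
    and E :: "nat \<Rightarrow> 'm \<Rightarrow> 'n" and a c :: "'m \<Rightarrow> real" and p :: nat
  assumes A: "\<forall>i j. A $ i $ j \<in> \<int>"
    and indep: "prob_space.indep_vars (measure_pmf X) (\<lambda>_. count_space UNIV) (\<lambda>j x. x $ j) UNIV"
    and geom: "\<And>j k. measure_pmf.prob X {x. x $ j = k} = (1 - Q j) * Q j ^ k"
    and Q: "\<And>j. 0 \<le> Q j" "\<And>j. Q j < 1"
    and E: "bij_betw (\<lambda>(k, r). E k r) ({1..p} \<times> UNIV) UNIV"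
    and det: "\<And>k. k \<in> {1..p} \<Longrightarrow> det ((\<chi> r i. A $ i $ E k r) :: real^'m^'m) \<noteq> 0"
    and le: "\<And>k r. k \<in> {1..p} \<Longrightarrow> a r \<le> 2 * Q (E k r) / (1 - Q (E k r))\<^sup>2"
    and a: "\<And>r. 0 < a r" and \<gamma>: "0 < \<gamma>"
    and c: "\<And>r. c r = max (1 / \<gamma>\<^sup>2 * ln (1 + a r * (1 - cos (\<gamma> / sqrt (a r))))) (1 / (a r * pi\<^sup>2) * ln (1 + 2 * a r))"
    and C': "\<And>r. exp (- (\<gamma>\<^sup>2 * c r / 2)) \<le> C'"
    and p: "p > 0"
  shows "measure_pmf.prob X {x. A *v real_vec x = A *v real_vec x0}
    \<le> (\<Prod>r\<in>UNIV. (2 * pi * real p * c r * a r) powr (- 1 / 2)) + C' ^ p"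
proof -
  let ?P = "measure_pmf.prob X {x. A *v real_vec x = A *v real_vec x0}"
  define \<kappa> where "\<kappa> = (\<lambda>r. (2 * pi * real p * c r * a r) powr (- 1 / 2))"
  have "\<forall>k. \<exists>z. det ((\<chi> r i. A $ i $ E k r) :: real^'m^'m) = real_of_int z"
  proof
    fix k
    have "det ((\<chi> r i. A $ i $ E k r) :: real^'m^'m) \<in> \<int>" using A by (intro det_Ints) simp
    then show "\<exists>z. det ((\<chi> r i. A $ i $ E k r) :: real^'m^'m) = real_of_int z" by (auto elim!: Ints_cases)
  qed
  then obtain d where d: "\<And>k. det ((\<chi> r i. A $ i $ E k r) :: real^'m^'m) = real_of_int (d k)" by metis
  define D where "D = nat \<bar>\<Prod>k\<in>{1..p}. d k\<bar>"
  have "(\<Prod>k\<in>{1..p}. d k) \<noteq> 0" using det d by (auto simp: prod_zero_iff)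
  then have D: "D > 0" by (simp add: D_def)
  \<comment> \<open>This choice makes \<open>N L\<close> odd, coprime to every block determinant,
    and unbounded in \<open>L\<close>.\<close>
  define N where "N = (\<lambda>L. 2 * (D * L) + 1)"
  have bound: "?P \<le> (\<Prod>r\<in>UNIV. 1 / real (N L) + \<kappa> r) + C' ^ p" for L
  proof -
    have N0: "N L > 0" by (simp add: N_def)
    have cop: "coprime (d k) (int (N L))" if "k \<in> {1..p}" for k
    proof -
      have "d k dvd (\<Prod>k\<in>{1..p}. d k)" using that by (intro dvd_prodI) auto
      then have "d k dvd int (2 * (D * L))" by (simp add: D_def)
      then obtain z where z: "int (2 * (D * L)) = d k * z" by blast
      show ?thesis
      proof (rule coprimeI)
        fix q assume q: "q dvd d k" "q dvd int (N L)"
        then have "q dvd int (2 * (D * L))" using z by simp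
        with q(2) have "q dvd int (N L) - int (2 * (D * L))" by (rule dvd_diff)
        then show "is_unit q" by (simp add: N_def)
      qed
    qed
    have "real (N L) ^ CARD('m) * ?P \<le> (\<Prod>r\<in>UNIV. 1 + real (N L) * \<kappa> r) + real (N L) ^ CARD('m) * C' ^ p"
      unfolding \<kappa>_def
      by (rule order_trans[OF prob_linear_image_le_grid_sum[OF A indep geom Q N0]
            block_grid_sum_le[where \<beta> = "\<lambda>j. 2 * Q j / (1 - Q j)\<^sup>2" and E = E and d = d and M = "D * L",
              OF A E le d cop a \<gamma> c C' p]]) (simp_all add: N_def)
    also have "(\<Prod>r\<in>UNIV. 1 + real (N L) * \<kappa> r) = (\<Prod>r\<in>UNIV. real (N L) * (1 / real (N L) + \<kappa> r))"
      using N0 by (simp add: distrib_left)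
    also have "\<dots> = real (N L) ^ CARD('m) * (\<Prod>r\<in>UNIV. 1 / real (N L) + \<kappa> r)"
      by (simp add: prod.distrib)
    finally have "real (N L) ^ CARD('m) * ?P \<le> real (N L) ^ CARD('m) * ((\<Prod>r\<in>UNIV. 1 / real (N L) + \<kappa> r) + C' ^ p)"
      by (simp add: distrib_left)
    then show ?thesis using N0 by simp
  qed
  have "filterlim (\<lambda>L. real (N L)) at_top sequentially"
    unfolding filterlim_at_top
  proof
    fix Z :: real
    show "\<forall>\<^sub>F L in sequentially. Z \<le> real (N L)"
    proof (rule eventually_sequentiallyI)
      fix L assume L: "nat \<lceil>Z\<rceil> \<le> L"
      have "L \<le> D * L" using D by simp
      then have "L \<le> N L" unfolding N_def by linarith
      then show "Z \<le> real (N L)" using L by linarith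
    qed
  qed
  then have "(\<lambda>L. 1 / real (N L)) \<longlonglongrightarrow> 0"
    by (rule tendsto_divide_0[OF tendsto_const filterlim_at_top_imp_at_infinity])
  then have "(\<lambda>L. (\<Prod>r\<in>UNIV. 1 / real (N L) + \<kappa> r) + C' ^ p) \<longlonglongrightarrow> (\<Prod>r\<in>UNIV. 0 + \<kappa> r) + C' ^ p"
    by (intro tendsto_add tendsto_prod tendsto_const)
  then have "?P \<le> (\<Prod>r\<in>UNIV. 0 + \<kappa> r) + C' ^ p"
    using bound by (intro LIMSEQ_le_const) auto
  then show ?thesis by (simp add: \<kappa>_def)
qed

section \<open>Counting lattice points\<close>

text \<open>Every nonnegative integer solution has probability at least \<open>exp (- H)\<close>
  under \<open>X\<close>. Finiteness is proved separately since \<open>card\<close> is 0 on infinite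
  sets.\<close>

lemma card_integer_points_le:
  fixes A :: "real^'n^'m" and X :: "(nat^'n) pmf"
  assumes X: "max_entropy A b X" and fin: "entropy_pmf X \<noteq> \<infinity>"
  defines "S \<equiv> polyhedron_P A b \<inter> integer_points"
  shows "finite S"
    and "real (card S) \<le> exp (enn2real (entropy_pmf X)) * measure_pmf.prob X {x. A *v real_vec x = b}"
proof -
  let ?W = "{x. A *v real_vec x = b}"
  define h where "h = exp (- enn2real (entropy_pmf X))"
  have S: "S = real_vec ` ?W"
  proof (intro equalityI subsetI)
    fix y assume y: "y \<in> S"
    define x where "x = (\<chi> j. nat \<lfloor>y $ j\<rfloor>)"
    have "real (nat \<lfloor>y $ j\<rfloor>) = y $ j" for j
    proof -
      have "y $ j \<in> \<int>" "0 \<le> y $ j" using y by (auto simp: S_def integer_points_def polyhedron_P_def)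
      then show ?thesis by (auto elim!: Ints_cases)
    qed
    then have "real_vec x = y" by (simp add: vec_eq_iff real_vec_def x_def)
    moreover have "A *v y = b" using y by (simp add: S_def polyhedron_P_def)
    ultimately show "y \<in> real_vec ` ?W" by force
  qed (auto simp: S_def integer_points_def polyhedron_P_def real_vec_def)
  have ge: "h \<le> pmf X x" if "x \<in> ?W" for x
    using max_entropy_pmf_ge[OF X fin] that by (simp add: h_def)
  have h: "h > 0" by (simp add: h_def)
  have count: "h * real (card F) \<le> measure_pmf.prob X ?W" if "finite F" "F \<subseteq> ?W" for F
  proof -
    have "h * real (card F) = (\<Sum>x\<in>F. h)" by simp
    also have "\<dots> \<le> (\<Sum>x\<in>F. pmf X x)" using ge that by (intro sum_mono) auto
    also have "\<dots> = measure_pmf.prob X F" using that by (simp add: measure_measure_pmf_finite)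
    also have "\<dots> \<le> measure_pmf.prob X ?W" using that by (intro measure_pmf.finite_measure_mono) auto
    finally show ?thesis .
  qed
  have finW: "finite ?W"
  proof (rule ccontr)
    assume "infinite ?W"
    \<comment> \<open>More than \<open>1 / h\<close> points of mass at least \<open>h\<close> would
      have total probability above 1.\<close>
    then obtain F where F: "finite F" "card F = nat \<lceil>1 / h\<rceil> + 1" "F \<subseteq> ?W"
      using infinite_arbitrarily_large by metis
    have "real (card F) > 1 / h" using F(2) by linarith
    then have "h * real (card F) > 1" using h by (simp add: field_simps)
    with count[OF F(1,3)] measure_pmf.prob_le_1[of X ?W] show False by linarith
  qed
  then show "finite S" by (simp add: S)
  have "real (card S) \<le> real (card ?W)" unfolding S using finW by (simp add: card_image_le)
  also have "\<dots> = exp (enn2real (entropy_pmf X)) * (h * real (card ?W))"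
    by (simp add: h_def exp_minus)
  also have "\<dots> \<le> exp (enn2real (entropy_pmf X)) * measure_pmf.prob X ?W"
    using count[OF finW] by (intro mult_left_mono) auto
  finally show "real (card S) \<le> exp (enn2real (entropy_pmf X)) * measure_pmf.prob X ?W" .
qed

text \<open>Division of \<open>j - 1\<close> by \<open>m\<close> with remainder, both indices being
  counted from 1.\<close>

lemma bij_betw_block_index:
  fixes m p :: nat
  assumes "m > 0"
  shows "bij_betw (\<lambda>(k, i). (k - 1) * m + i) ({1..p} \<times> {1..m}) {1..p * m}"
proof (rule bij_betw_byWitness[where f' = "\<lambda>j. ((j - 1) div m + 1, (j - 1) mod m + 1)"])
  show "\<forall>x\<in>{1..p} \<times> {1..m}. (\<lambda>j. ((j - 1) div m + 1, (j - 1) mod m + 1)) ((\<lambda>(k, i). (k - 1) * m + i) x) = x"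
  proof
    fix x assume "x \<in> {1..p} \<times> {1..m}"
    then obtain k i where x: "x = (k, i)" and "k \<in> {1..p}" "i \<in> {1..m}" by blast
    then have eq: "(k - 1) * m + i - 1 = (i - 1) + m * (k - 1)" and i: "i - 1 < m" "k \<ge> 1" "i \<ge> 1"
      by (cases i; simp)+
    have "((i - 1) + m * (k - 1)) div m = k - 1" "((i - 1) + m * (k - 1)) mod m = i - 1"
      using i(1) assms unfolding div_mult_self2[OF less_imp_neq[OF assms, THEN not_sym]] mod_mult_self2 by auto
    then show "(\<lambda>j. ((j - 1) div m + 1, (j - 1) mod m + 1)) ((\<lambda>(k, i). (k - 1) * m + i) x) = x"
      unfolding x prod.case eq using i by simp
  qed
  show "\<forall>j\<in>{1..p * m}. (\<lambda>(k, i). (k - 1) * m + i) ((j - 1) div m + 1, (j - 1) mod m + 1) = j"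
    using div_mult_mod_eq by auto
  show "(\<lambda>(k, i). (k - 1) * m + i) ` ({1..p} \<times> {1..m}) \<subseteq> {1..p * m}"
  proof clarify
    fix k i assume ki: "k \<in> {1..p}" "i \<in> {1..m}"
    then have "(k - 1) * m + i \<le> (k - 1) * m + m" by simp
    also have "\<dots> = k * m" using ki by (cases k) auto
    also have "\<dots> \<le> p * m" using ki by simp
    finally show "(k - 1) * m + i \<in> {1..p * m}" using ki by simp
  qed
  show "(\<lambda>j. ((j - 1) div m + 1, (j - 1) mod m + 1)) ` {1..p * m} \<subseteq> {1..p} \<times> {1..m}"
  proof clarify
    fix j assume j: "j \<in> {1..p * m}"
    then have "(j - 1) div m < p" by (subst div_less_iff_less_mult) (use assms in auto)
    moreover have "(j - 1) mod m < m" using assms by simp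
    ultimately show "(j - 1) div m + 1 \<in> {1..p} \<and> (j - 1) mod m + 1 \<in> {1..m}" by auto
  qed
qed

theorem mainTheorem6:
  fixes A :: "real^'n^'m" and b :: "real^'m"
    and m n p :: nat
    and e :: "nat \<Rightarrow> 'n" and a :: "nat \<Rightarrow> real^'m"
    and X :: "(nat^'n) pmf"
    and q \<alpha> \<alpha>min qmin c :: "nat \<Rightarrow> real"
    and \<gamma> C C' :: real
  assumes m: "m = CARD('m)" and n: "n = CARD('n)"
    and A_int: "\<forall>i j. A $ i $ j \<in> \<int>"
    and n_gt_m: "n > m"
    and rank_A: "rank A = m"
    and enum: "bij_betw e {1..n} UNIV"
    and columns: "\<forall>j\<in>{1..n}. a j = column (e j) A"
    and X_max: "max_entropy A b X"
    and X_indep: "prob_space.indep_vars (measure_pmf X) (\<lambda>_. count_space UNIV) (\<lambda>j x. x $ j) UNIV"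
    and q_range: "\<forall>j\<in>{1..n}. 0 \<le> q j \<and> q j < 1"
    and X_geom: "\<forall>j\<in>{1..n}. \<forall>k. measure_pmf.prob X {x. x $ e j = k} = (1 - q j) * q j ^ k"
    and n_eq: "n = p * m"
    and blocks: "\<forall>k\<in>{1..p}. inj_on a {(k - 1) * m + 1..k * m} \<and>
                   independent (a ` {(k - 1) * m + 1..k * m})"
    and a_b: "\<forall>j\<in>{1..n}. a j \<bullet> b > 0"
    and \<gamma>: "\<gamma> > 0"
    and \<alpha>: "\<forall>j\<in>{1..n}. \<alpha> j = 2 * q j / (1 - q j)^2"
    and \<alpha>min: "\<forall>i\<in>{1..m}. \<alpha>min i = Min ((\<lambda>k. \<alpha> ((k - 1) * m + i)) ` {1..p})"
    and qmin: "\<forall>i\<in>{1..m}. qmin i = Min ((\<lambda>k. q ((k - 1) * m + i)) ` {1..p})"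
    and c: "\<forall>i\<in>{1..m}. c i =
              max (1 / \<gamma>^2 * ln (1 + \<alpha>min i * (1 - cos (\<gamma> / sqrt (\<alpha>min i)))))
                  (1 / (\<alpha>min i * pi^2) * ln (1 + 2 * \<alpha>min i))"
    and C: "C = (\<Prod>i=1..m. (2 * pi * c i * \<alpha>min i) powr (-1/2))"
    and C': "C' = Max ((\<lambda>i. exp (- (\<gamma>^2 * c i / 2))) ` {1..m})"
  shows "finite (polyhedron_P A b \<inter> integer_points) \<and>
         real (card (polyhedron_P A b \<inter> integer_points))
           \<le> exp (enn2real (entropy_pmf X)) * (C * real p powr (- real m / 2) + C' ^ p)"
proof -
  have m0: "m > 0" using m by simp
  have p0: "p > 0" using n_gt_m n_eq by (cases p) auto
  obtain \<tau> where "bij_betw \<tau> {1..m} (UNIV :: 'm set)"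
    using ex_bij_betw_nat_finite_1[of "UNIV :: 'm set"] m by auto
  then obtain \<sigma> :: "'m \<Rightarrow> nat" where \<sigma>: "bij_betw \<sigma> UNIV {1..m}"
    using bij_betw_the_inv_into by blast
  have \<sigma>_range: "\<sigma> r \<in> {1..m}" for r using \<sigma> by (auto simp: bij_betw_def)
  \<comment> \<open>\<open>\<sigma>\<close> numbers the abstract row indices, so that they also
    serve as positions inside a block of \<open>m\<close> columns.\<close>
  define idx where "idx = (\<lambda>k r. (k - 1) * m + \<sigma> r)"
  define E where "E = (\<lambda>k r. e (idx k r))"
  have "bij_betw (map_prod id \<sigma>) ({1..p} \<times> UNIV) ({1..p} \<times> {1..m})"
    using \<sigma> by (intro bij_betw_map_prod) auto
  from bij_betw_trans[OF this bij_betw_block_index[OF m0]]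
  have idx_bij: "bij_betw (\<lambda>(k, r). idx k r) ({1..p} \<times> UNIV) {1..n}"
    unfolding n_eq by (simp add: comp_def idx_def case_prod_unfold map_prod_def)
  from bij_betw_trans[OF this enum]
  have E_bij: "bij_betw (\<lambda>(k, r). E k r) ({1..p} \<times> UNIV) UNIV"
    by (simp add: comp_def E_def case_prod_unfold)
  have idx: "idx k r \<in> {1..n}" if "k \<in> {1..p}" for k r
    using bspec[OF bij_betwE[OF idx_bij], of "(k, r)"] that by simp
  \<comment> \<open>\<open>f\<close> inverts the enumeration of the columns, so that the parameters
    can be indexed by the type \<open>'n\<close>.\<close>
  define f where "f = the_inv_into {1..n} e"
  define Q where "Q = (\<lambda>j. q (f j))"
  have f_e: "f (e j) = j" if "j \<in> {1..n}" for j
    using that enum by (simp add: f_def the_inv_into_f_f bij_betw_def)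
  have f: "f j \<in> {1..n}" "e (f j) = j" for j
  proof -
    have "j \<in> e ` {1..n}" using enum by (simp add: bij_betw_def)
    then show "f j \<in> {1..n}" "e (f j) = j" using f_e by auto
  qed
  have Q: "0 \<le> Q j" "Q j < 1" for j using q_range f(1)[of j] by (auto simp: Q_def)
  have geom: "measure_pmf.prob X {x. x $ j = k} = (1 - Q j) * Q j ^ k" for j k
    using X_geom[rule_format, OF f(1)[of j], of k] by (simp add: f(2) Q_def)
  have fin: "entropy_pmf X \<noteq> \<infinity>" by (rule entropy_indep_geometric_finite[OF X_indep geom Q])
  note S = card_integer_points_le[OF X_max fin]
  have \<alpha>_nonneg: "0 \<le> \<alpha> j" if "j \<in> {1..n}" for j using \<alpha> q_range that by simp
  have \<alpha>min_le: "\<alpha>min (\<sigma> r) \<le> \<alpha> (idx k r)" if "k \<in> {1..p}" for k r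
    using \<alpha>min \<sigma>_range[of r] that by (auto simp: idx_def intro!: Min_le)
  have \<alpha>min_nonneg: "0 \<le> \<alpha>min (\<sigma> r)" for r
  proof -
    have "\<alpha>min (\<sigma> r) \<in> (\<lambda>k. \<alpha> (idx k r)) ` {1..p}"
      using \<alpha>min \<sigma>_range[of r] p0 unfolding idx_def by (simp only:) (intro Min_in; simp)
    then show ?thesis using idx \<alpha>_nonneg by auto
  qed
  have C'_ge: "exp (- (\<gamma>\<^sup>2 * c (\<sigma> r) / 2)) \<le> C'" for r
    using \<sigma>_range[of r] by (auto simp: C' intro!: Max_ge)
  have C_nonneg: "0 \<le> C" by (simp add: C prod_nonneg)
  have C'_nonneg: "0 \<le> C'" using C'_ge exp_ge_zero order_trans by blast
  have prob: "measure_pmf.prob X {x. A *v real_vec x = b} \<le> C * real p powr (- real m / 2) + C' ^ p"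
  proof (cases "\<forall>r. \<alpha>min (\<sigma> r) > 0")
    case False
    \<comment> \<open>With \<open>x / 0 = 0\<close> the constant \<open>c\<close> vanishes and \<open>C' \<ge> 1\<close>.\<close>
    then obtain r where "\<alpha>min (\<sigma> r) = 0" using \<alpha>min_nonneg by (meson antisym_conv1 linorder_not_less)
    then have "c (\<sigma> r) = 0" using c \<sigma>_range[of r] by simp
    then have "1 \<le> C'" using C'_ge[of r] by simp
    then have "1 \<le> C' ^ p" by simp
    moreover have "0 \<le> C * real p powr (- real m / 2)" using C_nonneg by simp
    ultimately show ?thesis using measure_pmf.prob_le_1[of X] by (smt (verit))
  next
    case True
    show ?thesis
    proof (cases "{x. A *v real_vec x = b} = {}")
      case False
      \<comment> \<open>The Fourier bound is centred at an integer solution. Without one the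
        probability is 0.\<close>
      then obtain x0 where x0: "A *v real_vec x0 = b" by blast
      have det: "det ((\<chi> r i. A $ i $ E k r) :: real^'m^'m) \<noteq> 0" if k: "k \<in> {1..p}" for k
      proof (rule det_nonzero_if_independent_rows)
        \<comment> \<open>The block matrix is transposed: its rows are columns of
          \<open>A\<close>.\<close>
        have row: "row r ((\<chi> r i. A $ i $ E k r) :: real^'m^'m) = a (idx k r)" for r
          using columns idx[OF k, of r] by (simp add: row_def column_def E_def vec_eq_iff)
        have block: "idx k r \<in> {(k - 1) * m + 1..k * m}" for r
          using \<sigma>_range[of r] k by (cases k) (auto simp: idx_def)
        have inj: "inj (idx k)" using \<sigma> by (auto simp: idx_def inj_on_def bij_betw_def)
        show "inj (\<lambda>r. row r ((\<chi> r i. A $ i $ E k r) :: real^'m^'m))"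
          unfolding row using blocks k block inj by (auto simp: inj_on_def)
        show "independent (range (\<lambda>r. row r ((\<chi> r i. A $ i $ E k r) :: real^'m^'m)))"
          unfolding row by (rule independent_mono[of "a ` {(k - 1) * m + 1..k * m}"]) (use blocks k block in auto)
      qed
      have le: "\<alpha>min (\<sigma> r) \<le> 2 * Q (E k r) / (1 - Q (E k r))\<^sup>2" if "k \<in> {1..p}" for k r
        using \<alpha>min_le[OF that, of r] \<alpha> idx[OF that, of r] by (simp add: Q_def E_def f_e)
      have cr: "c (\<sigma> r) = max (1 / \<gamma>\<^sup>2 * ln (1 + \<alpha>min (\<sigma> r) * (1 - cos (\<gamma> / sqrt (\<alpha>min (\<sigma> r))))))
          (1 / (\<alpha>min (\<sigma> r) * pi\<^sup>2) * ln (1 + 2 * \<alpha>min (\<sigma> r)))" for r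
        using c \<sigma>_range[of r] by simp
      have cpos: "0 < c (\<sigma> r)" for r
      proof -
        have "0 < 1 / (\<alpha>min (\<sigma> r) * pi\<^sup>2) * ln (1 + 2 * \<alpha>min (\<sigma> r))"
          using True[rule_format, of r] by (intro mult_pos_pos divide_pos_pos) auto
        then show ?thesis by (simp add: cr)
      qed
      have "measure_pmf.prob X {x. A *v real_vec x = b}
        \<le> (\<Prod>r\<in>UNIV. (2 * pi * real p * c (\<sigma> r) * \<alpha>min (\<sigma> r)) powr (- 1 / 2)) + C' ^ p"
        unfolding x0[symmetric]
        by (rule prob_linear_image_le[where Q = Q and E = E and \<gamma> = \<gamma>,
              OF A_int X_indep geom Q E_bij det le _ \<gamma> cr C'_ge p0]) (use True in auto)
      also have "(\<Prod>r\<in>UNIV. (2 * pi * real p * c (\<sigma> r) * \<alpha>min (\<sigma> r)) powr (- 1 / 2))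
        = (\<Prod>r\<in>UNIV. (2 * pi * c (\<sigma> r) * \<alpha>min (\<sigma> r)) powr (- 1 / 2) * real p powr (- 1 / 2))"
      proof (rule prod.cong)
        fix r
        \<comment> \<open>Splitting off \<open>p\<close> in each of the \<open>m\<close> factors
          produces the power \<open>- m / 2\<close>.\<close>
        have "(2 * pi * real p * c (\<sigma> r) * \<alpha>min (\<sigma> r)) = (2 * pi * c (\<sigma> r) * \<alpha>min (\<sigma> r)) * real p" by simp
        then show "(2 * pi * real p * c (\<sigma> r) * \<alpha>min (\<sigma> r)) powr (- 1 / 2)
           = (2 * pi * c (\<sigma> r) * \<alpha>min (\<sigma> r)) powr (- 1 / 2) * real p powr (- 1 / 2)"
          using True cpos[of r] by (simp only: powr_mult)
      qed simp
      also have "\<dots> = (\<Prod>r\<in>UNIV. (2 * pi * c (\<sigma> r) * \<alpha>min (\<sigma> r)) powr (- 1 / 2)) * (real p powr (- 1 / 2)) ^ m"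
        by (simp add: prod.distrib m)
      also have "(\<Prod>r\<in>UNIV. (2 * pi * c (\<sigma> r) * \<alpha>min (\<sigma> r)) powr (- 1 / 2)) = C"
        unfolding C by (rule prod.reindex_bij_betw[OF \<sigma>])
      also have "(real p powr (- 1 / 2)) ^ m = real p powr (- real m / 2)"
        using p0 by (simp add: powr_power)
      finally show ?thesis .
    qed (use C_nonneg C'_nonneg in simp)
  qed
  have "real (card (polyhedron_P A b \<inter> integer_points))
      \<le> exp (enn2real (entropy_pmf X)) * measure_pmf.prob X {x. A *v real_vec x = b}" by (rule S(2))
  also have "\<dots> \<le> exp (enn2real (entropy_pmf X)) * (C * real p powr (- real m / 2) + C' ^ p)"
    using prob by (intro mult_left_mono) auto
  finally show ?thesis using S(1) by simp
qed

end
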